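(* Let $(\mathbf X,\mathbf Y,\mathbf Z)$ be a 1-Markov process as described in the context, with causally sufficient conditioning sets $\mathcal C_t^{-\mathbf X}$. (i) If $\mathbf X\overset{\mathrm{ext}}{\longrightarrow}\mathbf Y$, then $\mathbf X\overset{\mathrm{tail}}{\longrightarrow}\mathbf Y$. (ii) Suppose in addition that $\mathbf Y$ is structurally generated, $Y_t=h_Y(X_{t-1},Y_{t-1},\mathbf Z_{t-1},\varepsilon^Y_t)$ for all $t\in\mathbb Z$, as described in the context, and that either $\lim_{x\to\infty}h_Y(x,y,\mathbf z,e)=\infty$ for all admissible values of $(y,\mathbf z,e)$, or $h_Y$ is constant in $x$. If $\mathbf X\overset{\mathrm{tail}}{\longrightarrow}\mathbf Y$, then $\mathbf X\overset{\mathrm{ext}}{\longrightarrow}\mathbf Y$.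
   Context: Setting. $\mathbf W=(\mathbf X,\mathbf Y,\mathbf Z)=((X_t,Y_t,\mathbf Z_t)^\top,t\in\mathbb Z)$ is a stochastic process on one probability space with $X_t,Y_t$ real-valued and $\mathbf Z_t$ finite-dimensional. It is 1-Markov: $\sigma(\mathbf W_s:s\ge t+1)$ and $\sigma(\mathbf W_s:s\le t-1)$ are conditionally independent given $\sigma(\mathbf W_t)$, for all $t$. $X_t$ and $Y_t$ are supported on some neighborhood of infinity for every $t$. Write $\mathrm{past}(t)=(t,t-1,t-2,\dots)$ and $\mathcal C_t^{-\mathbf X}=\sigma(\mathbf Y_{\mathrm{past}(t)},\mathbf Z_{\mathrm{past}(t)})$. Coefficients. $F$ is a fixed cumulative distribution function with $F(x)<1$ for all $x\in\mathbb R$. Define $\Gamma^t_{\mathbf X\to\mathbf Y\mid\mathcal C}=\lim_{v\to\infty}\mathbb E[F(Y_{t+1})\mid X_t>v,\mathcal C_t^{-\mathbf X}]$ and $\Gamma^{t,\mathrm{baseline}}_{\mathbf X\to\mathbf Y\mid\mathcal C}=\mathbb E[F(Y_{t+1})\mid\mathcal C_t^{-\mathbf X}]$. Here $\mathbb E[\,\cdot\mid X_t>v,\mathcal G]$ denotes $\mathbb E[\,\cdot\,\mathbf 1\{X_t>v\}\mid\mathcal G]/P(X_t>v\mid\mathcal G)$. The coefficients are assumed well defined (conditional probabilities in the denominators are a.s. positive and the limit exists a.s.). Causal relations. $\mathbf X\overset{\mathrm{tail}}{\longrightarrow}\mathbf Y$ means that for some $t\in\mathbb Z$ the variables $\Gamma^t_{\mathbf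 X\to\mathbf Y\mid\mathcal C}$ and $\Gamma^{t,\mathrm{baseline}}_{\mathbf X\to\mathbf Y\mid\mathcal C}$ are not almost surely equal. $\mathbf X\overset{\mathrm{ext}}{\longrightarrow}\mathbf Y$ means that for some $t\in\mathbb Z$, $\Gamma^t_{\mathbf X\to\mathbf Y\mid\mathcal C}=1$ almost surely. The notation without "$\mid\mathbf Z$" is used under the convention that $\mathcal C_t^{-\mathbf X}$ is causally sufficient: replacing it by any admissible enlargement of the information available up to time $t$ not containing $\mathbf X_{\mathrm{past}(t)}$ does not change whether the relation holds. Structural generation. $(\mathbf X,\mathbf Y,\mathbf Z)$ is (strictly) stationary, $h_Y$ is measurable, and the noise satisfies: $\varepsilon^Y_t$ is independent of $\sigma(X_s,Y_s,\mathbf Z_s:s<t)$ for all $t\in\mathbb Z$. *)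

theory Defs
  imports "HOL-Probability.Probability"
begin

definition generated_sigma ::
  "'w measure \<Rightarrow> 's measure \<Rightarrow> ('i \<Rightarrow> 'w \<Rightarrow> 's) \<Rightarrow> 'i set \<Rightarrow> 'w measure" where
  "generated_sigma M S V I =
     sigma (space M) {V i -` B \<inter> space M | i B. i \<in> I \<and> B \<in> sets S}"

definition cond_indep :: "'w measure \<Rightarrow> 'w measure \<Rightarrow> 'w measure \<Rightarrow> 'w measure \<Rightarrow> bool" where
  "cond_indep M G A B \<longleftrightarrow>
     (\<forall>a\<in>sets A. \<forall>b\<in>sets B. AE \<omega> in M.
        real_cond_exp M G (indicator (a \<inter> b)) \<omega>
          = real_cond_exp M G (indicator a) \<omega> * real_cond_exp M G (indicator b) \<omega>)"

definition one_markov :: "'w measure \<Rightarrow> (int \<Rightarrow> 'w \<Rightarrow> 's::topological_space) \<Rightarrow> bool" where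
  "one_markov M W \<longleftrightarrow>
     (\<forall>t. cond_indep M (generated_sigma M borel W {t})
            (generated_sigma M borel W {t + 1..}) (generated_sigma M borel W {..t - 1}))"

definition strictly_stationary ::
  "'w measure \<Rightarrow> (int \<Rightarrow> 'w \<Rightarrow> 's::topological_space) \<Rightarrow> bool" where
  "strictly_stationary M W \<longleftrightarrow>
     (\<forall>h. distr M (Pi\<^sub>M UNIV (\<lambda>_. borel)) (\<lambda>\<omega> t. W (t + h) \<omega>)
        = distr M (Pi\<^sub>M UNIV (\<lambda>_. borel)) (\<lambda>\<omega> t. W t \<omega>))"

definition law_support :: "'w measure \<Rightarrow> ('w \<Rightarrow> real) \<Rightarrow> real set" where
  "law_support M V =
     {x. \<forall>U. open U \<longrightarrow> x \<in> U \<longrightarrow> 0 < measure (distr M borel V) U}"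

definition supported_near_infinity :: "'w measure \<Rightarrow> ('w \<Rightarrow> real) \<Rightarrow> bool" where
  "supported_near_infinity M V \<longleftrightarrow> (\<exists>a. {a<..} \<subseteq> law_support M V)"

definition joint_process ::
  "(int \<Rightarrow> 'w \<Rightarrow> real) \<Rightarrow> (int \<Rightarrow> 'w \<Rightarrow> real) \<Rightarrow> (int \<Rightarrow> 'w \<Rightarrow> 'z) \<Rightarrow> int \<Rightarrow> 'w \<Rightarrow> real \<times> real \<times> 'z" where
  "joint_process X Y Z t \<omega> = (X t \<omega>, Y t \<omega>, Z t \<omega>)"

definition info_without_X ::
  "'w measure \<Rightarrow> (int \<Rightarrow> 'w \<Rightarrow> real) \<Rightarrow> (int \<Rightarrow> 'w \<Rightarrow> 'z::euclidean_space) \<Rightarrow> int \<Rightarrow> 'w measure" where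
  "info_without_X M Y Z t = generated_sigma M borel (\<lambda>s \<omega>. (Y s \<omega>, Z s \<omega>)) {..t}"

definition cond_prob_exceed ::
  "'w measure \<Rightarrow> 'w measure \<Rightarrow> ('w \<Rightarrow> real) \<Rightarrow> real \<Rightarrow> 'w \<Rightarrow> real" where
  "cond_prob_exceed M G V v = real_cond_exp M G (indicator {\<omega> \<in> space M. v < V \<omega>})"

definition cond_exp_exceed ::
  "'w measure \<Rightarrow> 'w measure \<Rightarrow> ('w \<Rightarrow> real) \<Rightarrow> ('w \<Rightarrow> real) \<Rightarrow> real \<Rightarrow> 'w \<Rightarrow> real" where
  "cond_exp_exceed M G f V v \<omega> =
     real_cond_exp M G (\<lambda>\<omega>'. f \<omega>' * indicator {\<omega> \<in> space M. v < V \<omega>} \<omega>') \<omega>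
       / cond_prob_exceed M G V v \<omega>"

text \<open>
  For each threshold \<open>v\<close> the conditional expectation is determined only up to a null set, and
  there are uncountably many thresholds; so the almost sure limit is taken along some choice of
  versions \<open>R v\<close>. Any two choices agree almost surely at all rational thresholds simultaneously,
  hence the limit \<open>g\<close> is almost surely unique. It exists exactly if the limit along rational
  thresholds exists almost surely, since right-continuous versions in \<open>v\<close> are available.
\<close>

definition is_tail_coefficient ::
  "'w measure \<Rightarrow> (real \<Rightarrow> real) \<Rightarrow> (int \<Rightarrow> 'w \<Rightarrow> real) \<Rightarrow> (int \<Rightarrow> 'w \<Rightarrow> real)
     \<Rightarrow> int \<Rightarrow> 'w measure \<Rightarrow> ('w \<Rightarrow> real) \<Rightarrow> bool" where
  "is_tail_coefficient M F X Y t G g \<longleftrightarrow>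
     g \<in> borel_measurable G \<and>
     (\<exists>R. (\<forall>v. R v \<in> borel_measurable G \<and>
             (AE \<omega> in M. R v \<omega> = cond_exp_exceed M G (\<lambda>\<omega>. F (Y (t + 1) \<omega>)) (X t) v \<omega>)) \<and>
          (AE \<omega> in M. ((\<lambda>v. R v \<omega>) \<longlongrightarrow> g \<omega>) at_top))"

definition tail_coefficient ::
  "'w measure \<Rightarrow> (real \<Rightarrow> real) \<Rightarrow> (int \<Rightarrow> 'w \<Rightarrow> real) \<Rightarrow> (int \<Rightarrow> 'w \<Rightarrow> real)
     \<Rightarrow> int \<Rightarrow> 'w measure \<Rightarrow> 'w \<Rightarrow> real" where
  "tail_coefficient M F X Y t G = (SOME g. is_tail_coefficient M F X Y t G g)"

definition baseline_coefficient ::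
  "'w measure \<Rightarrow> (real \<Rightarrow> real) \<Rightarrow> (int \<Rightarrow> 'w \<Rightarrow> real) \<Rightarrow> int \<Rightarrow> 'w measure \<Rightarrow> 'w \<Rightarrow> real" where
  "baseline_coefficient M F Y t G = real_cond_exp M G (\<lambda>\<omega>. F (Y (t + 1) \<omega>))"

definition coefficients_well_defined ::
  "'w measure \<Rightarrow> (real \<Rightarrow> real) \<Rightarrow> (int \<Rightarrow> 'w \<Rightarrow> real) \<Rightarrow> (int \<Rightarrow> 'w \<Rightarrow> real)
     \<Rightarrow> (int \<Rightarrow> 'w measure) \<Rightarrow> bool" where
  "coefficients_well_defined M F X Y C \<longleftrightarrow>
     (\<forall>t. (\<forall>v. AE \<omega> in M. 0 < cond_prob_exceed M (C t) (X t) v \<omega>) \<and>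
          (\<exists>g. is_tail_coefficient M F X Y t (C t) g))"

definition causes_in_tail ::
  "'w measure \<Rightarrow> (real \<Rightarrow> real) \<Rightarrow> (int \<Rightarrow> 'w \<Rightarrow> real) \<Rightarrow> (int \<Rightarrow> 'w \<Rightarrow> real)
     \<Rightarrow> (int \<Rightarrow> 'w measure) \<Rightarrow> bool" where
  "causes_in_tail M F X Y C \<longleftrightarrow>
     (\<exists>t. \<not> (AE \<omega> in M.
        tail_coefficient M F X Y t (C t) \<omega> = baseline_coefficient M F Y t (C t) \<omega>))"

definition causes_in_extremes ::
  "'w measure \<Rightarrow> (real \<Rightarrow> real) \<Rightarrow> (int \<Rightarrow> 'w \<Rightarrow> real) \<Rightarrow> (int \<Rightarrow> 'w \<Rightarrow> real)
     \<Rightarrow> (int \<Rightarrow> 'w measure) \<Rightarrow> bool" where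
  "causes_in_extremes M F X Y C \<longleftrightarrow>
     (\<exists>t. AE \<omega> in M. tail_coefficient M F X Y t (C t) \<omega> = 1)"

text \<open>
  \<open>U t\<close> is all the information available up to time \<open>t\<close>, possibly including variables other than
  those of the process \<open>W\<close>. (The library's \<open>filtration\<close> requires an index type of class
  \<open>second_countable_topology\<close>, of which \<open>int\<close> is not an instance.)
\<close>

definition available_information ::
  "'w measure \<Rightarrow> (int \<Rightarrow> 'w \<Rightarrow> 's::topological_space) \<Rightarrow> (int \<Rightarrow> 'w measure) \<Rightarrow> bool" where
  "available_information M W U \<longleftrightarrow>
     (\<forall>t. subalgebra M (U t) \<and> subalgebra (U t) (generated_sigma M borel W {..t})) \<and>
     (\<forall>s t. s \<le> t \<longrightarrow> subalgebra (U t) (U s))"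

text \<open>
  An enlargement has to leave the coefficients well defined, as otherwise the relations are
  meaningless for it.
\<close>

definition admissible_enlargement ::
  "'w measure \<Rightarrow> (real \<Rightarrow> real) \<Rightarrow> (int \<Rightarrow> 'w measure) \<Rightarrow> (int \<Rightarrow> 'w \<Rightarrow> real)
     \<Rightarrow> (int \<Rightarrow> 'w \<Rightarrow> real) \<Rightarrow> (int \<Rightarrow> 'w measure) \<Rightarrow> (int \<Rightarrow> 'w measure) \<Rightarrow> bool" where
  "admissible_enlargement M F U X Y C D \<longleftrightarrow>
     (\<forall>t. subalgebra (D t) (C t) \<and> subalgebra (U t) (D t) \<and>
          \<not> subalgebra (D t) (generated_sigma M borel X {..t})) \<and>
     coefficients_well_defined M F X Y D"

definition causally_sufficient ::
  "'w measure \<Rightarrow> (real \<Rightarrow> real) \<Rightarrow> (int \<Rightarrow> 'w measure) \<Rightarrow> (int \<Rightarrow> 'w \<Rightarrow> real)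
     \<Rightarrow> (int \<Rightarrow> 'w \<Rightarrow> real) \<Rightarrow> (int \<Rightarrow> 'w measure) \<Rightarrow> bool" where
  "causally_sufficient M F U X Y C \<longleftrightarrow>
     (\<forall>D. admissible_enlargement M F U X Y C D \<longrightarrow>
        (causes_in_tail M F X Y D \<longleftrightarrow> causes_in_tail M F X Y C) \<and>
        (causes_in_extremes M F X Y D \<longleftrightarrow> causes_in_extremes M F X Y C))"

text \<open>
  The noise takes values in an arbitrary measurable space \<open>N\<close>. The set \<open>A\<close> is the range of
  admissible values \<open>(y, z, e)\<close> of the last three arguments of \<open>h\<close>, which are those the model
  can attain; what \<open>h\<close> does outside of \<open>A\<close> is irrelevant.
\<close>

definition structurally_generated ::
  "'w measure \<Rightarrow> 'e measure \<Rightarrow> (int \<Rightarrow> 'w \<Rightarrow> real) \<Rightarrow> (int \<Rightarrow> 'w \<Rightarrow> real)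
     \<Rightarrow> (int \<Rightarrow> 'w \<Rightarrow> 'z::euclidean_space) \<Rightarrow> (int \<Rightarrow> 'w \<Rightarrow> 'e)
     \<Rightarrow> (real \<Rightarrow> real \<Rightarrow> 'z \<Rightarrow> 'e \<Rightarrow> real) \<Rightarrow> (real \<times> 'z \<times> 'e) set \<Rightarrow> bool" where
  "structurally_generated M N X Y Z \<epsilon> h A \<longleftrightarrow>
     strictly_stationary M (joint_process X Y Z) \<and>
     (\<lambda>(x, y, z, e). h x y z e)
        \<in> borel_measurable (borel \<Otimes>\<^sub>M (borel \<Otimes>\<^sub>M (borel \<Otimes>\<^sub>M N))) \<and>
     A \<in> sets (borel \<Otimes>\<^sub>M (borel \<Otimes>\<^sub>M N)) \<and>
     (\<forall>t. \<epsilon> t \<in> measurable M N \<and>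
          prob_space.indep_set M (sets (vimage_algebra (space M) (\<epsilon> t) N))
            (sets (generated_sigma M borel (joint_process X Y Z) {..<t})) \<and>
          (AE \<omega> in M. (Y (t - 1) \<omega>, Z (t - 1) \<omega>, \<epsilon> t \<omega>) \<in> A) \<and>
          (AE \<omega> in M. Y t \<omega> = h (X (t - 1) \<omega>) (Y (t - 1) \<omega>) (Z (t - 1) \<omega>) (\<epsilon> t \<omega>)))"

end

theory Submission
  imports Defs
begin

text \<open>
  (i) Since \<open>F < 1\<close>, the baseline coefficient is almost surely smaller than \<open>1\<close>, so a tail coefficient
  equal to \<open>1\<close> differs from it.

  (ii) Put \<open>\<Phi>(x, y, z) = E[F(h(x, y, z, \<epsilon>))]\<close>. Conditioning first on the full past and then on
  \<open>C_t\<close> shows that \<open>E[F(Y_{t+1}) | X_t > v, C_t]\<close> is the average of \<open>\<Phi>(\<cdot>, Y_t, Z_t)\<close> over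
  \<open>(v, \<infinity>)\<close> under a regular conditional distribution of \<open>X_t\<close> given \<open>C_t\<close>. If \<open>h \<rightarrow> \<infinity>\<close>, dominated
  convergence gives \<open>\<Phi> \<rightarrow> 1\<close> pointwise, so the averages tend to \<open>1\<close>; no uniformity in \<open>(y, z)\<close> is
  needed, because for fixed \<open>\<omega>\<close> only one function of \<open>x\<close> is averaged. If \<open>h\<close> is constant in \<open>x\<close>, so
  is \<open>\<Phi>\<close>, and the averages equal the baseline; then the tail relation fails.
\<close>

section \<open>Regular conditional distributions\<close>

text \<open>The first clause makes \<open>\<kappa>\<close> a Markov kernel from \<open>G\<close> to
  \<open>N\<close>. The second is the defining identity of conditional probability, integrated over
  the sets of \<open>G\<close> and stated in extended nonnegative reals, so that no integrability
  has to be carried along. For a subalgebra \<open>G\<close> of \<open>M\<close> each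
  \<open>a\<close> lies in \<open>space M\<close>, hence the preimage of \<open>b\<close> is not
  intersected with it.\<close>

definition regular_cond_distr ::
  "'a measure \<Rightarrow> 'a measure \<Rightarrow> 'b measure \<Rightarrow> ('a \<Rightarrow> 'b) \<Rightarrow> ('a \<Rightarrow> 'b measure) \<Rightarrow> bool" where
  "regular_cond_distr M G N V \<kappa> \<longleftrightarrow>
     \<kappa> \<in> measurable G (prob_algebra N) \<and>
     (\<forall>a\<in>sets G. \<forall>b\<in>sets N.
        emeasure M (a \<inter> V -` b) = (\<integral>\<^sup>+\<omega>. indicator a \<omega> * emeasure (\<kappa> \<omega>) b \<partial>M))"

lemma (in prob_space) subalgebra_imp_sigma_finite:
  assumes "subalgebra M G"
  shows "sigma_finite_subalgebra M G"
proof -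
  interpret finite_measure_subalgebra M G
    by unfold_locales (rule assms)
  show ?thesis by unfold_locales
qed

lemma regular_cond_distrD:
  assumes "regular_cond_distr M G N V \<kappa>" "subalgebra M G" "\<omega> \<in> space M"
  shows "prob_space (\<kappa> \<omega>)" "sets (\<kappa> \<omega>) = sets N" "space (\<kappa> \<omega>) = space N"
proof -
  have "\<kappa> \<omega> \<in> space (prob_algebra N)"
    using assms measurable_space[of \<kappa> G "prob_algebra N" \<omega>]
    by (auto simp: regular_cond_distr_def subalgebra_def)
  then show "prob_space (\<kappa> \<omega>)" "sets (\<kappa> \<omega>) = sets N"
    by (auto simp: space_prob_algebra)
  then show "space (\<kappa> \<omega>) = space N"
    using sets_eq_imp_space_eq by blast
qed

section \<open>Disintegration and conditional expectations as kernel integrals\<close>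

text \<open>The joint law of \<open>\<omega>\<close> and \<open>V \<omega>\<close> on
  \<open>G \<Otimes>\<^sub>M N\<close> and the mixture of the kernel over \<open>M\<close> agree on
  rectangles by definition of \<open>\<kappa>\<close>. Rectangles form an intersection-stable
  generator, so the two measures coincide, and \<open>f\<close> has the same integral under
  both.\<close>

lemma (in prob_space) regular_cond_distr_nn_integral:
  assumes \<kappa>: "regular_cond_distr M G N V \<kappa>" and G: "subalgebra M G"
    and V[measurable]: "V \<in> measurable M N"
    and f[measurable]: "f \<in> borel_measurable (G \<Otimes>\<^sub>M N)"
  shows "(\<integral>\<^sup>+\<omega>. f (\<omega>, V \<omega>) \<partial>M) = (\<integral>\<^sup>+\<omega>. \<integral>\<^sup>+e. f (\<omega>, e) \<partial>\<kappa> \<omega> \<partial>M)"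
    and "(\<lambda>\<omega>. \<integral>\<^sup>+e. f (\<omega>, e) \<partial>\<kappa> \<omega>) \<in> borel_measurable G"
proof -
  let ?R = "restr_to_subalg M G" and ?P = "G \<Otimes>\<^sub>M N"
  \<comment> \<open>\<open>?k \<omega>\<close> is the point mass at \<open>\<omega>\<close> times
    \<open>\<kappa> \<omega>\<close>; this places all kernels on one product space, where the
    mixture is a monadic bind over \<open>M\<close> restricted to \<open>G\<close>.\<close>
  let ?k = "\<lambda>\<omega>. distr (\<kappa> \<omega>) ?P (Pair \<omega>)"
  have spG: "space G = space M" using G by (simp add: subalgebra_def)
  have idG[measurable]: "(\<lambda>\<omega>. \<omega>) \<in> measurable M G"
    using G by (auto simp: subalgebra_def intro!: measurableI)
  have k1[measurable]: "\<kappa> \<in> measurable G (subprob_algebra N)"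
    using \<kappa> by (auto simp: regular_cond_distr_def measurable_prob_algebraD)
  have k2: "?k \<in> measurable G (subprob_algebra ?P)"
    by (rule measurable_distr2[where M=N]) simp_all
  have k3: "?k \<in> measurable ?R (subprob_algebra ?P)"
    using k2 measurable_in_subalg[OF G] by blast
  let ?E = "{a \<times> b | a b. a \<in> sets G \<and> b \<in> sets N}"
  have eq: "distr M ?P (\<lambda>\<omega>. (\<omega>, V \<omega>)) = ?R \<bind> ?k"
  proof (rule measure_eqI_generator_eq_countable[where E="?E" and \<Omega>="space G \<times> space N" and A="{space G \<times> space N}"])
    show "Int_stable ?E" by (rule Int_stable_pair_measure_generator)
    show "?E \<subseteq> Pow (space G \<times> space N)" by (rule pair_measure_closed)
    show "sets (distr M ?P (\<lambda>\<omega>. (\<omega>, V \<omega>))) = sigma_sets (space G \<times> space N) ?E"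
      by (simp add: sets_pair_measure)
    have "sets (?R \<bind> ?k) = sets ?P"
      by (rule sets_bind[OF sets_kernel[OF k3]]) (auto simp: space_restr_to_subalg not_empty)
    then show "sets (?R \<bind> ?k) = sigma_sets (space G \<times> space N) ?E"
      by (simp add: sets_pair_measure)
  next
    fix Q assume "Q \<in> ?E"
    then obtain a b where Q: "Q = a \<times> b" and a[measurable]: "a \<in> sets G" and b[measurable]: "b \<in> sets N" by auto
    have aM: "a \<subseteq> space M" using sets.sets_into_space[OF a] spG by simp
    have "emeasure (distr M ?P (\<lambda>\<omega>. (\<omega>, V \<omega>))) Q = emeasure M (a \<inter> V -` b)"
      unfolding Q using aM by (subst emeasure_distr) (auto intro!: arg_cong[where f="emeasure M"])
    also have "\<dots> = (\<integral>\<^sup>+\<omega>. indicator a \<omega> * emeasure (\<kappa> \<omega>) b \<partial>M)"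
      using \<kappa> a b by (simp add: regular_cond_distr_def)
    also have "\<dots> = (\<integral>\<^sup>+\<omega>. indicator a \<omega> * emeasure (\<kappa> \<omega>) b \<partial>?R)"
      by (rule nn_integral_subalgebra2[OF G, symmetric]) measurable
    also have "\<dots> = (\<integral>\<^sup>+\<omega>. emeasure (?k \<omega>) Q \<partial>?R)"
    proof (rule nn_integral_cong)
      fix \<omega> assume "\<omega> \<in> space ?R"
      then have w: "\<omega> \<in> space M" by (simp add: space_restr_to_subalg)
      have "Pair \<omega> \<in> measurable (\<kappa> \<omega>) ?P"
        using w spG by (simp cong: measurable_cong_sets add: regular_cond_distrD[OF \<kappa> G w])
      then have "emeasure (?k \<omega>) Q = emeasure (\<kappa> \<omega>) (Pair \<omega> -` Q \<inter> space (\<kappa> \<omega>))"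
        unfolding Q by (rule emeasure_distr) measurable
      moreover have "Pair \<omega> -` Q \<inter> space (\<kappa> \<omega>) = (if \<omega> \<in> a then b else {})"
        using sets.sets_into_space[OF b] by (auto simp: Q regular_cond_distrD[OF \<kappa> G w])
      ultimately show "indicator a \<omega> * emeasure (\<kappa> \<omega>) b = emeasure (?k \<omega>) Q"
        by simp
    qed
    also have "\<dots> = emeasure (?R \<bind> ?k) Q"
      unfolding Q by (rule emeasure_bind[symmetric, OF _ k3]) (auto simp: space_restr_to_subalg not_empty)
    finally show "emeasure (distr M ?P (\<lambda>\<omega>. (\<omega>, V \<omega>))) Q = emeasure (?R \<bind> ?k) Q" .
  next
    interpret D: prob_space "distr M ?P (\<lambda>\<omega>. (\<omega>, V \<omega>))"
      by (rule prob_space_distr) measurable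
    fix a show "emeasure (distr M ?P (\<lambda>\<omega>. (\<omega>, V \<omega>))) a \<noteq> \<infinity>" by simp
  qed auto
  have in_eq: "(\<integral>\<^sup>+p. f p \<partial>?k \<omega>) = (\<integral>\<^sup>+e. f (\<omega>, e) \<partial>\<kappa> \<omega>)" if w: "\<omega> \<in> space M" for \<omega>
  proof -
    have "Pair \<omega> \<in> measurable (\<kappa> \<omega>) ?P"
      using w spG by (simp cong: measurable_cong_sets add: regular_cond_distrD[OF \<kappa> G w])
    then show ?thesis by (simp add: nn_integral_distr)
  qed
  have "(\<lambda>\<omega>. \<integral>\<^sup>+p. f p \<partial>?k \<omega>) \<in> borel_measurable G"
    by (rule measurable_compose[OF k2]) measurable
  then show m: "(\<lambda>\<omega>. \<integral>\<^sup>+e. f (\<omega>, e) \<partial>\<kappa> \<omega>) \<in> borel_measurable G"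
    by (subst (asm) measurable_cong[OF in_eq]) (simp_all add: spG)
  have "(\<integral>\<^sup>+\<omega>. f (\<omega>, V \<omega>) \<partial>M) = (\<integral>\<^sup>+p. f p \<partial>distr M ?P (\<lambda>\<omega>. (\<omega>, V \<omega>)))"
    by (rule nn_integral_distr[symmetric]) measurable
  also have "\<dots> = (\<integral>\<^sup>+\<omega>. \<integral>\<^sup>+p. f p \<partial>?k \<omega> \<partial>?R)"
    unfolding eq by (rule nn_integral_bind[OF f k3])
  also have "\<dots> = (\<integral>\<^sup>+\<omega>. \<integral>\<^sup>+e. f (\<omega>, e) \<partial>\<kappa> \<omega> \<partial>?R)"
    by (rule nn_integral_cong) (simp add: in_eq space_restr_to_subalg)
  also have "\<dots> = (\<integral>\<^sup>+\<omega>. \<integral>\<^sup>+e. f (\<omega>, e) \<partial>\<kappa> \<omega> \<partial>M)"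
    by (rule nn_integral_subalgebra2[OF G m])
  finally show "(\<integral>\<^sup>+\<omega>. f (\<omega>, V \<omega>) \<partial>M) = (\<integral>\<^sup>+\<omega>. \<integral>\<^sup>+e. f (\<omega>, e) \<partial>\<kappa> \<omega> \<partial>M)" .
qed

text \<open>The kernel integral with \<open>\<omega>\<close> frozen in the first argument is
  \<open>G\<close>-measurable and, by disintegration of \<open>f\<close> times the indicator of
  \<open>a\<close>, has the right integral over each \<open>a\<close> in \<open>G\<close>. These two
  properties characterize the conditional expectation.\<close>

lemma (in prob_space) regular_cond_distr_real_cond_exp:
  fixes f :: "'a \<times> 'b \<Rightarrow> real"
  assumes \<kappa>: "regular_cond_distr M G N V \<kappa>" and G: "subalgebra M G"
    and V[measurable]: "V \<in> measurable M N"
    and f[measurable]: "f \<in> borel_measurable (G \<Otimes>\<^sub>M N)"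
    and f0: "\<And>p. 0 \<le> f p" and fB: "\<And>p. f p \<le> B"
  shows "AE \<omega> in M. real_cond_exp M G (\<lambda>\<omega>. f (\<omega>, V \<omega>)) \<omega> = (\<integral>e. f (\<omega>, e) \<partial>\<kappa> \<omega>)"
proof -
  interpret G: sigma_finite_subalgebra M G
    using subalgebra_imp_sigma_finite[OF G] .
  have spG: "space G = space M" using G by (simp add: subalgebra_def)
  have idG[measurable]: "(\<lambda>\<omega>. \<omega>) \<in> measurable M G"
    using G by (auto simp: subalgebra_def intro!: measurableI)
  have fw[measurable]: "(\<lambda>e. f (\<omega>, e)) \<in> borel_measurable (\<kappa> \<omega>)" if w: "\<omega> \<in> space M" for \<omega>
    using w spG by (simp cong: measurable_cong_sets add: regular_cond_distrD[OF \<kappa> G w])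
  have intw: "integrable (\<kappa> \<omega>) (\<lambda>e. f (\<omega>, e))" if w: "\<omega> \<in> space M" for \<omega>
  proof -
    interpret K: prob_space "\<kappa> \<omega>" using regular_cond_distrD[OF \<kappa> G w] by simp
    show ?thesis
      by (rule K.integrable_const_bound[where B=B]) (auto simp: f0 fB fw[OF w])
  qed
  let ?g = "\<lambda>\<omega>. \<integral>e. f (\<omega>, e) \<partial>\<kappa> \<omega>"
  have nn: "(\<integral>\<^sup>+e. ennreal (f (\<omega>, e)) \<partial>\<kappa> \<omega>) = ennreal (?g \<omega>)" if "\<omega> \<in> space M" for \<omega>
    by (rule nn_integral_eq_integral) (auto simp: intw that f0)
  have g0: "0 \<le> ?g \<omega>" for \<omega> by (rule integral_nonneg_AE) (simp add: f0)
  have gB: "?g \<omega> \<le> B" if w: "\<omega> \<in> space M" for \<omega>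
  proof -
    interpret K: prob_space "\<kappa> \<omega>" using regular_cond_distrD[OF \<kappa> G w] by simp
    show ?thesis by (rule K.integral_le_const) (auto simp: fB intw w)
  qed
  \<comment> \<open>Measurability in \<open>G\<close> is available for the nonnegative integral;
    \<open>enn2real\<close> carries it over to the Bochner integral, with which it agrees by
    \<open>nn\<close>.\<close>
  have "(\<lambda>\<omega>. enn2real (\<integral>\<^sup>+e. ennreal (f (\<omega>, e)) \<partial>\<kappa> \<omega>)) \<in> borel_measurable G"
    using regular_cond_distr_nn_integral(2)[OF \<kappa> G V, of "\<lambda>p. ennreal (f p)"] by simp
  moreover have "enn2real (\<integral>\<^sup>+e. ennreal (f (\<omega>, e)) \<partial>\<kappa> \<omega>) = ?g \<omega>" if "\<omega> \<in> space G" for \<omega>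
    using nn[of \<omega>] that g0[of \<omega>] spG by simp
  ultimately have gG: "?g \<in> borel_measurable G"
    using measurable_cong[of G "\<lambda>\<omega>. enn2real (\<integral>\<^sup>+e. ennreal (f (\<omega>, e)) \<partial>\<kappa> \<omega>)" ?g borel] by blast
  note gM[measurable] = measurable_from_subalg[OF G gG]
  have intf: "integrable M (\<lambda>\<omega>. f (\<omega>, V \<omega>))"
    by (rule integrable_const_bound[where B=B]) (auto simp: f0 fB)
  have intg: "integrable M ?g"
    by (rule integrable_const_bound[where B=B]) (auto simp: g0 gB)
  show ?thesis
  proof (rule G.real_cond_exp_charact[OF _ intf intg gG])
    fix a assume a[measurable]: "a \<in> sets G"
    have aM[measurable]: "a \<in> sets M" using a G by (auto simp: subalgebra_def)
    let ?f = "\<lambda>p. ennreal (indicator a (fst p) * f p)"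
    have "ennreal (\<integral>\<omega>\<in>a. f (\<omega>, V \<omega>) \<partial>M) = (\<integral>\<^sup>+\<omega>. ?f (\<omega>, V \<omega>) \<partial>M)"
      unfolding set_lebesgue_integral_def
      by (subst nn_integral_eq_integral)
         (auto intro!: integrable_mult_indicator[OF aM intf, simplified] simp: f0)
    also have "\<dots> = (\<integral>\<^sup>+\<omega>. \<integral>\<^sup>+e. ?f (\<omega>, e) \<partial>\<kappa> \<omega> \<partial>M)"
      by (rule regular_cond_distr_nn_integral(1)[OF \<kappa> G V]) measurable
    also have "\<dots> = (\<integral>\<^sup>+\<omega>. ennreal (indicator a \<omega> * ?g \<omega>) \<partial>M)"
    proof (rule nn_integral_cong)
      fix \<omega> assume "\<omega> \<in> space M"
      then show "(\<integral>\<^sup>+e. ?f (\<omega>, e) \<partial>\<kappa> \<omega>) = ennreal (indicator a \<omega> * ?g \<omega>)"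
        by (cases "\<omega> \<in> a") (simp_all add: nn)
    qed
    also have "\<dots> = ennreal (\<integral>\<omega>\<in>a. ?g \<omega> \<partial>M)"
      unfolding set_lebesgue_integral_def
      by (subst nn_integral_eq_integral)
         (auto intro!: integrable_mult_indicator[OF aM intg, simplified] simp: g0)
    finally show "(\<integral>\<omega>\<in>a. f (\<omega>, V \<omega>) \<partial>M) = (\<integral>\<omega>\<in>a. ?g \<omega> \<partial>M)"
      by (subst (asm) ennreal_inj)
         (auto simp: set_lebesgue_integral_def f0 g0 intro!: integral_nonneg_AE)
  qed
qed

section \<open>Conditional distributions of independent variables and of images\<close>

text \<open>For a constant kernel the defining identity is exactly the product formula. This
  supplies the conditional law of the noise given the past.\<close>

lemma (in prob_space) regular_cond_distr_indep:
  assumes G: "subalgebra M G" and V[measurable]: "V \<in> measurable M N"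
    and ind: "\<And>a b. a \<in> sets G \<Longrightarrow> b \<in> sets N \<Longrightarrow>
      prob (a \<inter> V -` b) = prob a * prob (V -` b \<inter> space M)"
  shows "regular_cond_distr M G N V (\<lambda>_. distr M N V)"
  unfolding regular_cond_distr_def
proof (intro conjI ballI)
  show "(\<lambda>_. distr M N V) \<in> measurable G (prob_algebra N)"
    by (intro measurable_const) (simp add: space_prob_algebra prob_space_distr)
  fix a b assume a: "a \<in> sets G" and b: "b \<in> sets N"
  then have "a \<in> sets M" using G by (auto simp: subalgebra_def)
  then show "emeasure M (a \<inter> V -` b) = (\<integral>\<^sup>+\<omega>. indicator a \<omega> * emeasure (distr M N V) b \<partial>M)"
    using ind[OF a b] b
    by (simp add: emeasure_eq_measure emeasure_distr nn_integral_multc ennreal_mult' mult.commute)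
qed

text \<open>Preimages compose, so kernels push forward along \<open>f\<close>. This serves to return
  from a bounded transform of a variable to the variable itself.\<close>

lemma (in prob_space) regular_cond_distr_comp:
  assumes \<kappa>: "regular_cond_distr M G N V \<kappa>" and G: "subalgebra M G"
    and V: "V \<in> measurable M N" and f[measurable]: "f \<in> measurable N L"
  shows "regular_cond_distr M G L (\<lambda>\<omega>. f (V \<omega>)) (\<lambda>\<omega>. distr (\<kappa> \<omega>) L f)"
  unfolding regular_cond_distr_def
proof (intro conjI ballI)
  have "\<kappa> \<in> measurable G (prob_algebra N)"
    using \<kappa> by (simp add: regular_cond_distr_def)
  then show "(\<lambda>\<omega>. distr (\<kappa> \<omega>) L f) \<in> measurable G (prob_algebra L)"
    by (rule measurable_compose) (rule measurable_distr_prob_space[OF f])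
  fix a b assume a: "a \<in> sets G" and b[measurable]: "b \<in> sets L"
  let ?b = "f -` b \<inter> space N"
  have "a \<subseteq> space M" using G sets.sets_into_space[OF a] by (auto simp: subalgebra_def)
  then have "a \<inter> (\<lambda>\<omega>. f (V \<omega>)) -` b = a \<inter> V -` ?b"
    using measurable_space[OF V] by auto
  moreover have "emeasure M (a \<inter> V -` ?b) = (\<integral>\<^sup>+\<omega>. indicator a \<omega> * emeasure (\<kappa> \<omega>) ?b \<partial>M)"
    using \<kappa> a measurable_sets[OF f b] unfolding regular_cond_distr_def by blast
  moreover have "emeasure (distr (\<kappa> \<omega>) L f) b = emeasure (\<kappa> \<omega>) ?b" if "\<omega> \<in> space M" for \<omega>
    using regular_cond_distrD[OF \<kappa> G that]
    by (subst emeasure_distr) (simp_all cong: measurable_cong_sets)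
  ultimately show "emeasure M (a \<inter> (\<lambda>\<omega>. f (V \<omega>)) -` b) =
      (\<integral>\<^sup>+\<omega>. indicator a \<omega> * emeasure (distr (\<kappa> \<omega>) L f) b \<partial>M)"
    by (simp cong: nn_integral_cong)
qed

section \<open>Existence of regular conditional distributions on the real line\<close>

text \<open>Conditional probabilities of the events that \<open>V\<close> is at most
  \<open>q\<close>, for rational \<open>q\<close>, are assembled into a distribution function
  \<open>H \<omega>\<close>; its Stieltjes measure is the kernel. Boundedness of \<open>V\<close>
  fixes the limits of \<open>H \<omega>\<close> at both infinities without exceptional null
  sets.\<close>

lemma (in prob_space) ex_regular_cond_distr_bounded:
  fixes V :: "'a \<Rightarrow> real"
  assumes G: "subalgebra M G" and V[measurable]: "V \<in> borel_measurable M"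
    and bd: "\<And>\<omega>. \<bar>V \<omega>\<bar> < 2"
  shows "\<exists>\<kappa>. regular_cond_distr M G borel V \<kappa>"
proof -
  interpret G: sigma_finite_subalgebra M G
    using subalgebra_imp_sigma_finite[OF G] .
  have spG: "space G = space M" using G by (simp add: subalgebra_def)
  define J where "J q = (indicator (V -` {..q} \<inter> space M) :: 'a \<Rightarrow> real)" for q
  \<comment> \<open>Since \<open>\<bar>V\<bar> < 2\<close>, the first two branches change nothing almost surely; with them and the
    clipping to \<open>[0, 1]\<close>, \<open>H \<omega>\<close> is a distribution function for every single \<open>\<omega>\<close>.\<close>
  define c where "c q \<omega> = (if q < - 2 then 0 else if 2 \<le> q then 1
      else max 0 (min 1 (real_cond_exp M G (J q) \<omega>)))" for q \<omega>
  \<comment> \<open>The infimum runs over rationals strictly above \<open>x\<close>: this makes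
    \<open>H \<omega>\<close> monotone and right-continuous even where \<open>c\<close> is not
    monotone in \<open>q\<close>, and countability keeps it measurable in
    \<open>\<omega>\<close>.\<close>
  define H where "H \<omega> x = (INF q\<in>{q\<in>\<rat>. x < q}. c q \<omega>)" for \<omega> x
  have Jm[measurable]: "J q \<in> borel_measurable M" for q
    unfolding J_def by measurable
  have Jint: "integrable M (J q)" for q
    unfolding J_def by (simp add: emeasure_eq_measure)
  have c01: "0 \<le> c q \<omega>" "c q \<omega> \<le> 1" for q \<omega>
    by (auto simp: c_def)
  have cG[measurable]: "c q \<in> borel_measurable G" for q
    unfolding c_def by measurable
  have bdd: "bdd_below ((\<lambda>q. c q \<omega>) ` S)" for \<omega> S
    by (rule bdd_belowI[where m=0]) (auto simp: c01)
  have ratx: "\<exists>q\<in>\<rat>. x < q \<and> q < y" if "x < y" for x y :: real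
    using Rats_dense_in_real[OF that] by blast
  have ne: "{q\<in>\<rat>. x < q} \<noteq> {}" for x :: real
    using ratx[of x "x + 1"] by auto
  have H_le: "H \<omega> x \<le> c q \<omega>" if "q \<in> \<rat>" "x < q" for \<omega> x q
    unfolding H_def by (rule cINF_lower[OF bdd]) (use that in auto)
  have H_ge: "y \<le> H \<omega> x" if "\<And>q. q \<in> \<rat> \<Longrightarrow> x < q \<Longrightarrow> y \<le> c q \<omega>" for \<omega> x y
    unfolding H_def by (rule cINF_greatest[OF ne]) (use that in auto)
  have H01: "0 \<le> H \<omega> x" "H \<omega> x \<le> 1" for \<omega> x
  proof -
    show "0 \<le> H \<omega> x" by (rule H_ge) (rule c01)
    show "H \<omega> x \<le> 1" using ratx[of x "x+1"] H_le c01(2) by (metis less_add_one order_trans)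
  qed
  have HG[measurable]: "(\<lambda>\<omega>. H \<omega> x) \<in> borel_measurable G" for x
    unfolding H_def
    by (rule borel_measurable_cINF_real) (auto intro: countable_subset[OF _ countable_rat])
  have H_mono: "H \<omega> x \<le> H \<omega> y" if "x \<le> y" for \<omega> x y
    by (rule H_ge) (use that H_le in auto)
  have H_right: "continuous (at_right x) (H \<omega>)" for \<omega> x
    unfolding continuous_within
  proof (rule order_tendstoI)
    fix y assume "y < H \<omega> x"
    then have "y < H \<omega> z" if "x < z" for z
      using H_mono[of x z \<omega>] that by simp
    then show "\<forall>\<^sub>F z in at_right x. y < H \<omega> z"
      by (auto simp: eventually_at_filter)
  next
    fix y assume "H \<omega> x < y"
    \<comment> \<open>A single rational \<open>q\<close> above \<open>x\<close> with
      \<open>c q \<omega> < y\<close> bounds \<open>H \<omega>\<close> on everything below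
      \<open>q\<close>, which contains a right neighborhood of \<open>x\<close>.\<close>
    then obtain q where q: "q \<in> \<rat>" "x < q" "c q \<omega> < y"
      using H_ge[of x y \<omega>] by (meson not_le)
    then have "H \<omega> z < y" if "z < q" for z
      using H_le[of q z \<omega>] that by simp
    with q show "\<forall>\<^sub>F z in at_right x. H \<omega> z < y"
      by (auto simp: eventually_at_right)
  qed
  have H_bot: "(H \<omega> \<longlongrightarrow> 0) at_bot" for \<omega>
  proof (rule tendsto_eventually)
    have "H \<omega> x = 0" if x: "x < - 2" for x
    proof -
      obtain q where "q \<in> \<rat>" "x < q" "q < - 2" using ratx[OF x] by auto
      then have "H \<omega> x \<le> 0" using H_le[of q x \<omega>] by (simp add: c_def)
      then show ?thesis using H01[of \<omega> x] by simp
    qed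
    then show "\<forall>\<^sub>F x in at_bot. H \<omega> x = 0"
      using eventually_at_bot_dense by blast
  qed
  have H_top: "(H \<omega> \<longlongrightarrow> 1) at_top" for \<omega>
  proof (rule tendsto_eventually)
    have "H \<omega> x = 1" if "2 < x" for x
      using H01[of \<omega> x] H_ge[of x 1 \<omega>] that by (force simp: c_def)
    then show "\<forall>\<^sub>F x in at_top. H \<omega> x = 1"
      using eventually_at_top_dense by blast
  qed
  let ?k = "\<lambda>\<omega>. interval_measure (H \<omega>)"
  have rd: "real_distribution (?k \<omega>)" for \<omega>
    by (rule real_distribution_interval_measure[OF H_mono H_right H_bot H_top])
  have kIic: "emeasure (?k \<omega>) {..x} = ennreal (H \<omega> x)" for \<omega> x
    by (rule emeasure_interval_measure_Iic[OF H_mono H_right H_bot])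
  have gen: "sets borel = sigma_sets UNIV (range (\<lambda>x::real. {..x}))"
    by (subst borel_eq_atMost) simp
  have Int: "Int_stable (range (\<lambda>x::real. {..x}))"
    by (auto simp: Int_stable_def)
  \<comment> \<open>Measurability of a probability kernel need only be tested on the generating
    half-lines, where its value is \<open>H \<omega> x\<close>.\<close>
  have kp: "?k \<in> measurable G (prob_algebra borel)"
  proof (rule measurable_prob_algebra_generated[OF gen Int])
    show "prob_space (?k \<omega>)" for \<omega>
      using rd[of \<omega>] by (simp add: real_distribution_def)
    show "(\<lambda>\<omega>. emeasure (?k \<omega>) A) \<in> borel_measurable G" if "A \<in> range (\<lambda>x::real. {..x})" for A
      using that by (auto simp: kIic)
  qed auto
  have ks: "?k \<in> measurable G (subprob_algebra borel)"
    using kp by (rule measurable_prob_algebraD)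
  have cAE: "AE \<omega> in M. c q \<omega> = real_cond_exp M G (J q) \<omega>" for q
  proof -
    have 0: "AE \<omega> in M. 0 \<le> real_cond_exp M G (J q) \<omega>"
      by (rule G.real_cond_exp_ge_c[OF Jint]) (simp add: J_def)
    have 1: "AE \<omega> in M. real_cond_exp M G (J q) \<omega> \<le> 1"
      by (rule G.real_cond_exp_le_c[OF Jint]) (simp add: J_def)
    consider "q < - 2" | "- 2 \<le> q" "q < 2" | "2 \<le> q" by linarith
    then show ?thesis
    proof cases
      case 1
      have "AE \<omega> in M. real_cond_exp M G (J q) \<omega> \<le> 0"
      proof (rule G.real_cond_exp_le_c[OF Jint], rule AE_I2)
        fix \<omega> show "J q \<omega> \<le> 0" using bd[of \<omega>] 1 by (auto simp: J_def indicator_def)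
      qed
      with 0 1 show ?thesis by (auto simp: c_def)
    next
      case 2
      with 0 1 show ?thesis by (auto simp: c_def)
    next
      case 3
      have "AE \<omega> in M. 1 \<le> real_cond_exp M G (J q) \<omega>"
      proof (rule G.real_cond_exp_ge_c[OF Jint], rule AE_I2)
        fix \<omega> assume "\<omega> \<in> space M"
        then show "1 \<le> J q \<omega>" using bd[of \<omega>] 3 by (auto simp: J_def indicator_def)
      qed
      with 1 3 show ?thesis by (auto simp: c_def)
    qed
  qed
  have cM[measurable]: "c q \<in> borel_measurable M" for q
    using measurable_from_subalg[OF G cG] .
  have HM[measurable]: "(\<lambda>\<omega>. H \<omega> x) \<in> borel_measurable M" for x
    using measurable_from_subalg[OF G HG] .
  have cint: "integrable M (c q)" for q
    by (rule integrable_const_bound[where B=1]) (auto simp: c01)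
  have Hint: "integrable M (\<lambda>\<omega>. H \<omega> x)" for x
    by (rule integrable_const_bound[where B=1]) (auto simp: H01)
  have Eint: "integrable M (real_cond_exp M G (J q))" for q
    using G.real_cond_exp_int(1)[OF Jint] .
  interpret D: real_distribution "distr M borel V"
    by (rule real_distribution_distr) measurable
  have cI: "(\<integral>\<omega>. c q \<omega> \<partial>M) = cdf (distr M borel V) q" for q
  proof -
    have "(\<integral>\<omega>. c q \<omega> \<partial>M) = (\<integral>\<omega>. real_cond_exp M G (J q) \<omega> \<partial>M)"
      using cAE by (intro integral_cong_AE) auto
    also have "\<dots> = (\<integral>\<omega>. J q \<omega> \<partial>M)" by (rule G.real_cond_exp_int(2)[OF Jint])
    also have "\<dots> = cdf (distr M borel V) q"
      by (simp add: J_def cdf_def measure_distr)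
    finally show ?thesis .
  qed
  \<comment> \<open>\<open>H\<close> dominates the conditional probability and has no larger integral, by right-continuity of
    the unconditional distribution function.\<close>
  have HAE: "AE \<omega> in M. real_cond_exp M G (J x) \<omega> = H \<omega> x" for x
  proof (rule integral_ineq_eq_0_then_AE[OF _ Eint Hint])
    have "AE \<omega> in M. \<forall>q\<in>{q\<in>\<rat>. x < q}. real_cond_exp M G (J x) \<omega> \<le> c q \<omega>"
    proof (subst AE_ball_countable)
      show "countable {q\<in>\<rat>. x < q}" by (auto intro: countable_subset[OF _ countable_rat])
      show "\<forall>q\<in>{q\<in>\<rat>. x < q}. AE \<omega> in M. real_cond_exp M G (J x) \<omega> \<le> c q \<omega>"
      proof
        fix q assume q: "q \<in> {q\<in>\<rat>. x < q}"
        have "AE \<omega> in M. real_cond_exp M G (J x) \<omega> \<le> real_cond_exp M G (J q) \<omega>"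
          using q by (intro G.real_cond_exp_mono Jint AE_I2) (auto simp: J_def indicator_def)
        with cAE[of q] show "AE \<omega> in M. real_cond_exp M G (J x) \<omega> \<le> c q \<omega>" by auto
      qed
    qed
    then show "AE \<omega> in M. real_cond_exp M G (J x) \<omega> \<le> H \<omega> x"
      by eventually_elim (auto intro: H_ge)
    then have "(\<integral>\<omega>. real_cond_exp M G (J x) \<omega> \<partial>M) \<le> (\<integral>\<omega>. H \<omega> x \<partial>M)"
      by (intro integral_mono_AE Eint Hint)
    moreover have "(\<integral>\<omega>. real_cond_exp M G (J x) \<omega> \<partial>M) = cdf (distr M borel V) x"
      using G.real_cond_exp_int(2)[OF Jint[of x]] by (simp add: J_def cdf_def measure_distr)
    moreover have "(\<integral>\<omega>. H \<omega> x \<partial>M) \<le> cdf (distr M borel V) x"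
    proof (rule ccontr)
      assume "\<not> ?thesis"
      then have "cdf (distr M borel V) x < (\<integral>\<omega>. H \<omega> x \<partial>M)" by simp
      moreover have "(cdf (distr M borel V) \<longlongrightarrow> cdf (distr M borel V) x) (at_right x)"
        using D.cdf_is_right_cont[of x] by (simp add: continuous_within)
      ultimately have "\<forall>\<^sub>F y in at_right x. cdf (distr M borel V) y < (\<integral>\<omega>. H \<omega> x \<partial>M)"
        by (rule order_tendstoD(2)[rotated])
      then obtain b where b: "x < b" "\<And>y. x < y \<Longrightarrow> y < b \<Longrightarrow> cdf (distr M borel V) y < (\<integral>\<omega>. H \<omega> x \<partial>M)"
        unfolding eventually_at_right_field by auto
      obtain q where q: "q \<in> \<rat>" "x < q" "q < b" using ratx[OF b(1)] by auto
      \<comment> \<open>The integral of \<open>c q\<close> is the distribution function at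
        \<open>q\<close>, which lies strictly below the integral of \<open>H\<close> by the choice
        of \<open>q\<close>: a contradiction.\<close>
      have "(\<integral>\<omega>. H \<omega> x \<partial>M) \<le> (\<integral>\<omega>. c q \<omega> \<partial>M)"
        by (intro integral_mono Hint cint H_le q)
      with b(2)[OF q(2,3)] show False by (simp add: cI)
    qed
    ultimately show "(\<integral>\<omega>. real_cond_exp M G (J x) \<omega> \<partial>M) = (\<integral>\<omega>. H \<omega> x \<partial>M)" by simp
  qed
  have "regular_cond_distr M G borel V ?k"
    unfolding regular_cond_distr_def
  proof (intro conjI ballI kp)
    fix a and b :: "real set" assume a: "a \<in> sets G" and b: "b \<in> sets borel"
    have aM[measurable]: "a \<in> sets M" using a G by (auto simp: subalgebra_def)
    have aS: "a \<subseteq> space M" by (rule sets.sets_into_space[OF aM])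
    \<comment> \<open>With \<open>a\<close> fixed, both sides of the identity are read as finite
      measures in \<open>b\<close>: the law of \<open>V\<close> under \<open>M\<close> restricted to
      \<open>a\<close>, and the mixture of the kernel over that restriction. It then suffices to
      compare them on half-lines.\<close>
    let ?M = "density M (indicator a)"
    have ksM[measurable]: "?k \<in> measurable M (subprob_algebra borel)"
      by (rule measurable_from_subalg[OF G ks])
    have ksD: "?k \<in> measurable ?M (subprob_algebra borel)" by simp
    have L: "emeasure (distr ?M borel V) b = emeasure M (a \<inter> V -` b)"
      if [measurable]: "b \<in> sets borel" for b
    proof -
      have "emeasure (distr ?M borel V) b = (\<integral>\<^sup>+\<omega>. indicator a \<omega> * indicator (V -` b \<inter> space M) \<omega> \<partial>M)"
        by (simp add: emeasure_distr emeasure_density)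
      also have "\<dots> = emeasure M (a \<inter> (V -` b \<inter> space M))"
        by (simp flip: indicator_inter_arith)
      also have "a \<inter> (V -` b \<inter> space M) = a \<inter> V -` b" using aS by auto
      finally show ?thesis .
    qed
    have R: "emeasure (?M \<bind> ?k) b = (\<integral>\<^sup>+\<omega>. indicator a \<omega> * emeasure (?k \<omega>) b \<partial>M)"
      if [measurable]: "b \<in> sets borel" for b
      by (subst emeasure_bind[OF _ ksD that])
         (auto simp: not_empty nn_integral_density)
    have "distr ?M borel V = ?M \<bind> ?k"
    proof (rule measure_eqI_generator_eq[OF Int])
      show "sets (?M \<bind> ?k) = sigma_sets UNIV (range (\<lambda>x::real. {..x}))"
        unfolding gen[symmetric] by (rule sets_bind) (auto simp: not_empty)
      show "range (\<lambda>n. {..real n}) \<subseteq> range (\<lambda>x::real. {..x})" by auto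
      show "(\<Union>n. {..real n}) = UNIV" using real_arch_simple by auto
      show "emeasure (distr ?M borel V) {..real n} \<noteq> \<infinity>" for n
        by (simp add: L)
    next
      fix b assume "b \<in> range (\<lambda>x::real. {..x})"
      then obtain x where b: "b = {..x}" by auto
      have "measure M (a \<inter> V -` b) = (\<integral>\<omega>\<in>a. J x \<omega> \<partial>M)"
      proof -
        have "a \<inter> V -` b = a \<inter> (V -` {..x} \<inter> space M)" using aS b by auto
        then show ?thesis
          by (simp add: set_lebesgue_integral_def J_def flip: indicator_inter_arith)
      qed
      also have "\<dots> = (\<integral>\<omega>\<in>a. real_cond_exp M G (J x) \<omega> \<partial>M)"
        by (rule G.real_cond_exp_intA[OF Jint a])
      also have "\<dots> = (\<integral>\<omega>\<in>a. H \<omega> x \<partial>M)"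
        using HAE[of x] by (intro set_lebesgue_integral_cong_AE) auto
      finally have "ennreal (measure M (a \<inter> V -` b)) = ennreal (\<integral>\<omega>. indicator a \<omega> * H \<omega> x \<partial>M)"
        by (simp add: set_lebesgue_integral_def)
      also have "\<dots> = (\<integral>\<^sup>+\<omega>. ennreal (indicator a \<omega> * H \<omega> x) \<partial>M)"
        by (rule nn_integral_eq_integral[symmetric])
           (auto intro!: integrable_mult_indicator[OF aM Hint, simplified] simp: H01)
      also have "\<dots> = (\<integral>\<^sup>+\<omega>. indicator a \<omega> * emeasure (?k \<omega>) b \<partial>M)"
        by (rule nn_integral_cong) (auto simp: b kIic ennreal_mult' ennreal_indicator)
      finally show "emeasure (distr ?M borel V) b = emeasure (?M \<bind> ?k) b"
        by (simp add: L R b emeasure_eq_measure)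
    qed (auto simp: gen)
    then show "emeasure M (a \<inter> V -` b) = (\<integral>\<^sup>+\<omega>. indicator a \<omega> * emeasure (?k \<omega>) b \<partial>M)"
      using L[OF b] R[OF b] by simp
  qed
  then show ?thesis by blast
qed

text \<open>The range of \<open>arctan\<close> lies within half of \<pi> of zero, hence inside the
  bound \<open>2\<close> because \<pi> is less than 4. A kernel for
  \<open>arctan (V \<omega>)\<close> is pushed forward by \<open>tan\<close>, which inverts
  \<open>arctan\<close> exactly.\<close>

lemma (in prob_space) ex_regular_cond_distr_real:
  fixes V :: "'a \<Rightarrow> real"
  assumes G: "subalgebra M G" and V[measurable]: "V \<in> borel_measurable M"
  shows "\<exists>\<kappa>. regular_cond_distr M G borel V \<kappa>"
proof -
  have "\<bar>arctan x\<bar> < 2" for x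
    using arctan_bounded[of x] pi_less_4 by auto
  then obtain \<kappa> where "regular_cond_distr M G borel (\<lambda>\<omega>. arctan (V \<omega>)) \<kappa>"
    using ex_regular_cond_distr_bounded[OF G, of "\<lambda>\<omega>. arctan (V \<omega>)"] by auto
  then have "regular_cond_distr M G borel (\<lambda>\<omega>. tan (arctan (V \<omega>))) (\<lambda>\<omega>. distr (\<kappa> \<omega>) borel tan)"
    by (rule regular_cond_distr_comp[OF _ G]) (auto simp: tan_def[abs_def])
  then show ?thesis by (auto simp: tan_arctan)
qed

section \<open>Coefficients of a structurally generated process\<close>

text \<open>Once \<open>f\<close> stays close to \<open>l\<close> beyond some \<open>N\<close>, so
  does each of its averages over a half-line starting beyond \<open>N\<close>, whatever the law
  \<open>K\<close>. Integer thresholds are enough for the application and involve only countably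
  many null sets.\<close>

lemma tail_average_tendsto:
  fixes f :: "real \<Rightarrow> real"
  assumes K: "real_distribution K" and f[measurable]: "f \<in> borel_measurable borel"
    and bd: "\<And>x. \<bar>f x\<bar> \<le> B" and lim: "(f \<longlongrightarrow> l) at_top"
    and pos: "\<And>n::nat. 0 < measure K {real n<..}"
  shows "(\<lambda>n::nat. (\<integral>x. f x * indicator {real n<..} x \<partial>K) / measure K {real n<..}) \<longlonglongrightarrow> l"
proof (rule tendstoI)
  interpret real_distribution K by (rule K)
  fix e :: real assume e: "0 < e"
  \<comment> \<open>Half of \<open>e\<close> is used because integration turns the strict bound into
    a weak one.\<close>
  then have "\<forall>\<^sub>F x in at_top. dist (f x) l < e / 2"
    using lim by (auto dest: tendstoD[where e="e/2"])
  then obtain N where N: "\<And>x. x \<ge> N \<Longrightarrow> \<bar>f x - l\<bar> < e / 2"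
    by (auto simp: eventually_at_top_linorder dist_real_def)
  have [measurable]: "f \<in> borel_measurable K" by simp
  have int: "integrable K (\<lambda>x. f x * indicator {v<..} x)" for v
    by (rule integrable_const_bound[where B="\<bar>B\<bar>"])
       (use bd in \<open>auto simp: indicator_def intro!: AE_I2 order_trans[OF bd]\<close>)
  have "dist ((\<integral>x. f x * indicator {v<..} x \<partial>K) / measure K {v<..}) l < e"
    if v: "N \<le> v" and p: "0 < measure K {v<..}" for v
  proof -
    have "(\<integral>x. f x * indicator {v<..} x \<partial>K) - l * measure K {v<..}
        = (\<integral>x. (f x - l) * indicator {v<..} x \<partial>K)"
      by (subst left_diff_distrib, subst Bochner_Integration.integral_diff)
         (auto simp: int emeasure_eq_measure)
    also have "\<bar>\<dots>\<bar> \<le> (\<integral>x. e / 2 * indicator {v<..} x \<partial>K)"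
    proof (rule order_trans[OF integral_abs_bound], rule integral_mono_AE')
      show "AE x in K. \<bar>(f x - l) * indicator {v<..} x\<bar> \<le> e / 2 * indicator {v<..} x"
        using N v by (auto simp: indicator_def intro!: less_imp_le)
    qed (use e in \<open>auto simp: emeasure_eq_measure\<close>)
    also have "\<dots> = e / 2 * measure K {v<..}" by simp
    finally have "\<bar>(\<integral>x. f x * indicator {v<..} x \<partial>K) - l * measure K {v<..}\<bar> \<le> e / 2 * measure K {v<..}" .
    then have "\<bar>(\<integral>x. f x * indicator {v<..} x \<partial>K) / measure K {v<..} - l\<bar> \<le> e / 2"
      using p by (simp add: field_simps abs_le_iff)
    then show ?thesis using e by (simp add: dist_real_def)
  qed
  moreover have "\<forall>\<^sub>F n in sequentially. N \<le> real n"
    using eventually_ge_at_top[of "nat \<lceil>N\<rceil>"] by eventually_elim linarith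
  ultimately show "\<forall>\<^sub>F n in sequentially.
      dist ((\<integral>x. f x * indicator {real n<..} x \<partial>K) / measure K {real n<..}) l < e"
    using pos by (auto elim: eventually_mono)
qed

text \<open>The tower property in two stages: given \<open>H\<close>, both \<open>V\<close> and
  \<open>T\<close> are known and only \<open>\<xi>\<close> is averaged, under \<open>\<nu>\<close>;
  given \<open>G\<close>, \<open>T\<close> is still known and \<open>V\<close> is averaged under
  \<open>\<kappa>\<close>.\<close>

lemma (in prob_space) real_cond_exp_indep_noise:
  fixes f :: "real \<times> 'c \<times> 'e \<Rightarrow> real"
  assumes H: "subalgebra M H" and G: "subalgebra H G"
    and V: "V \<in> borel_measurable H" and T[measurable]: "T \<in> measurable G L"
    and \<xi>[measurable]: "\<xi> \<in> measurable M N"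
    and noise: "regular_cond_distr M H N \<xi> (\<lambda>_. \<nu>)"
    and \<kappa>: "regular_cond_distr M G borel V \<kappa>"
    and f[measurable]: "f \<in> borel_measurable (borel \<Otimes>\<^sub>M (L \<Otimes>\<^sub>M N))"
    and f0: "\<And>p. 0 \<le> f p" and f1: "\<And>p. f p \<le> 1"
    and S[measurable]: "S \<in> sets borel"
  shows "AE \<omega> in M. real_cond_exp M G (\<lambda>\<omega>. f (V \<omega>, T \<omega>, \<xi> \<omega>) * indicator S (V \<omega>)) \<omega>
      = (\<integral>x. (\<integral>e. f (x, T \<omega>, e) \<partial>\<nu>) * indicator S x \<partial>\<kappa> \<omega>)"
proof -
  have MG: "subalgebra M G" using H G by (auto simp: subalgebra_def)
  interpret G: sigma_finite_subalgebra M G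
    using subalgebra_imp_sigma_finite[OF MG] .
  interpret H: sigma_finite_subalgebra M H
    using subalgebra_imp_sigma_finite[OF H] .
  obtain \<omega>0 where w0: "\<omega>0 \<in> space M" using not_empty by auto
  interpret \<nu>: prob_space \<nu> using regular_cond_distrD(1)[OF noise H w0] .
  have [measurable_cong]: "sets \<nu> = sets N" using regular_cond_distrD(2)[OF noise H w0] .
  note VH[measurable] = V
  note TH[measurable] = measurable_from_subalg[OF G T]
  note VM[measurable] = measurable_from_subalg[OF H V]
  note TM[measurable] = measurable_from_subalg[OF MG T]
  let ?\<Phi> = "\<lambda>x c. \<integral>e. f (x, c, e) \<partial>\<nu>"
  have \<Phi>[measurable]: "(\<lambda>(x, c). ?\<Phi> x c) \<in> borel_measurable (borel \<Otimes>\<^sub>M L)"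
    by measurable
  have \<Phi>0: "0 \<le> ?\<Phi> x c" for x c by (rule integral_nonneg_AE) (simp add: f0)
  have \<Phi>1: "?\<Phi> x c \<le> 1" for x c
  \<comment> \<open>For \<open>c\<close> outside \<open>space L\<close> the section of
    \<open>f\<close> may fail to be measurable; the Bochner integral then has the default value 0,
    which also obeys the bound.\<close>
  proof (cases "integrable \<nu> (\<lambda>e. f (x, c, e))")
    case True
    then show ?thesis by (intro \<nu>.integral_le_const) (auto simp: f1)
  qed (simp add: not_integrable_integral_eq)
  let ?F = "\<lambda>\<omega>. f (V \<omega>, T \<omega>, \<xi> \<omega>) * indicator S (V \<omega>)"
  have int: "integrable M ?F"
    by (rule integrable_const_bound[where B=1]) (auto simp: indicator_def f0 f1)
  have "AE \<omega> in M. real_cond_exp M H (\<lambda>\<omega>. (\<lambda>(\<omega>, e). f (V \<omega>, T \<omega>, e) * indicator S (V \<omega>)) (\<omega>, \<xi> \<omega>)) \<omega>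
      = (\<integral>e. (\<lambda>(\<omega>, e). f (V \<omega>, T \<omega>, e) * indicator S (V \<omega>)) (\<omega>, e) \<partial>\<nu>)"
    by (rule regular_cond_distr_real_cond_exp[OF noise H \<xi>, where B=1])
       (measurable, auto simp: indicator_def f0 f1)
  then have 1: "AE \<omega> in M. real_cond_exp M H ?F \<omega> = ?\<Phi> (V \<omega>) (T \<omega>) * indicator S (V \<omega>)"
    by simp
  have "AE \<omega> in M. real_cond_exp M G (\<lambda>\<omega>. (\<lambda>(\<omega>, x). ?\<Phi> x (T \<omega>) * indicator S x) (\<omega>, V \<omega>)) \<omega>
      = (\<integral>x. (\<lambda>(\<omega>, x). ?\<Phi> x (T \<omega>) * indicator S x) (\<omega>, x) \<partial>\<kappa> \<omega>)"
    by (rule regular_cond_distr_real_cond_exp[OF \<kappa> MG VM, where B=1])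
       (measurable, auto simp: indicator_def \<Phi>0 \<Phi>1)
  then have 2: "AE \<omega> in M. real_cond_exp M G (\<lambda>\<omega>. ?\<Phi> (V \<omega>) (T \<omega>) * indicator S (V \<omega>)) \<omega>
      = (\<integral>x. ?\<Phi> x (T \<omega>) * indicator S x \<partial>\<kappa> \<omega>)"
    by simp
  have 3: "AE \<omega> in M. real_cond_exp M G (real_cond_exp M H ?F) \<omega>
      = real_cond_exp M G (\<lambda>\<omega>. ?\<Phi> (V \<omega>) (T \<omega>) * indicator S (V \<omega>)) \<omega>"
    by (rule G.real_cond_exp_cong[OF 1]) (auto intro!: measurable_from_subalg[OF H])
  have 4: "AE \<omega> in M. real_cond_exp M G (real_cond_exp M H ?F) \<omega> = real_cond_exp M G ?F \<omega>"
    by (rule G.real_cond_exp_nested_subalg[OF H G int])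
  from 2 3 4 show ?thesis by eventually_elim simp
qed

text \<open>The complement of \<open>A\<close> is null for the joint law, so by disintegration its
  sections are null for almost every kernel measure. Thus an almost sure constraint on the realized
  value of \<open>V\<close> becomes one on almost every possible value, with \<open>\<omega>\<close>
  fixed.\<close>

lemma (in prob_space) AE_regular_cond_distr:
  assumes \<kappa>: "regular_cond_distr M G N V \<kappa>" and G: "subalgebra M G"
    and V[measurable]: "V \<in> measurable M N"
    and A[measurable]: "A \<in> sets (G \<Otimes>\<^sub>M N)" and AE: "AE \<omega> in M. (\<omega>, V \<omega>) \<in> A"
  shows "AE \<omega> in M. AE e in \<kappa> \<omega>. (\<omega>, e) \<in> A"
proof -
  have spG: "space G = space M" using G by (simp add: subalgebra_def)
  have idG[measurable]: "(\<lambda>\<omega>. \<omega>) \<in> measurable M G"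
    using G by (auto simp: subalgebra_def intro!: measurableI)
  let ?f = "indicator (space (G \<Otimes>\<^sub>M N) - A) :: _ \<Rightarrow> ennreal"
  have f: "?f \<in> borel_measurable (G \<Otimes>\<^sub>M N)" by measurable
  note nn = regular_cond_distr_nn_integral[OF \<kappa> G V f]
  have "(\<integral>\<^sup>+\<omega>. \<integral>\<^sup>+e. ?f (\<omega>, e) \<partial>\<kappa> \<omega> \<partial>M) = (\<integral>\<^sup>+\<omega>. ?f (\<omega>, V \<omega>) \<partial>M)"
    by (rule nn(1)[symmetric])
  also have "\<dots> = (\<integral>\<^sup>+\<omega>. 0 \<partial>M)"
    using AE by (intro nn_integral_cong_AE) (auto simp: indicator_def)
  finally have "AE \<omega> in M. (\<integral>\<^sup>+e. ?f (\<omega>, e) \<partial>\<kappa> \<omega>) = 0"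
    using measurable_from_subalg[OF G nn(2)] by (simp add: nn_integral_0_iff_AE)
  from this AE_space show ?thesis
  proof eventually_elim
    case (elim \<omega>)
    note 0 = elim(1) and w = elim(2)
    have "Pair \<omega> \<in> measurable (\<kappa> \<omega>) (G \<Otimes>\<^sub>M N)"
      using w spG by (simp cong: measurable_cong_sets add: regular_cond_distrD[OF \<kappa> G w])
    then have "(\<lambda>e. ?f (\<omega>, e)) \<in> borel_measurable (\<kappa> \<omega>)"
      using f by (rule measurable_compose)
    with 0 have "AE e in \<kappa> \<omega>. ?f (\<omega>, e) = 0"
      by (simp add: nn_integral_0_iff_AE)
    from this AE_space show ?case
      by eventually_elim
         (use w spG regular_cond_distrD[OF \<kappa> G w] in
           \<open>auto simp: indicator_def space_pair_measure split: if_splits\<close>)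
  qed
qed

section \<open>Generated sigma-algebras\<close>

lemma generated_sigma_space [simp]: "space (generated_sigma M S V I) = space M"
  by (simp add: generated_sigma_def space_measure_of_conv)

lemma generated_sigma_measurable:
  assumes "i \<in> I" "V i \<in> space M \<rightarrow> space S"
  shows "V i \<in> measurable (generated_sigma M S V I) S"
  using assms unfolding generated_sigma_def
  by (intro measurableI) (auto simp: space_measure_of_conv sets_measure_of_conv intro!: sigma_sets.Basic)

lemma subalgebra_generated_sigma:
  assumes "space N = space M" "\<And>i. i \<in> I \<Longrightarrow> V i \<in> measurable N S"
  shows "subalgebra N (generated_sigma M S V I)"
  unfolding subalgebra_def
proof
  show "space (generated_sigma M S V I) = space N" using assms by simp
  let ?E = "{V i -` B \<inter> space M | i B. i \<in> I \<and> B \<in> sets S}"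
  have "?E \<subseteq> sets N"
    using measurable_sets[OF assms(2)] by (auto simp: assms(1))
  then have "sigma_sets (space N) ?E \<subseteq> sets N" by (rule sets.sigma_sets_subset)
  moreover have "?E \<subseteq> Pow (space M)" by auto
  ultimately show "sets (generated_sigma M S V I) \<subseteq> sets N"
    by (simp add: generated_sigma_def assms(1))
qed

section \<open>Tail coefficients in the divergent and the constant case\<close>

text \<open>Almost surely, \<open>g\<close> is the limit of \<open>\<Phi>\<close> along its first
  argument whenever that limit exists. Each assumption on \<open>h\<close> determines the limit: 1
  if \<open>h\<close> diverges, the baseline if \<open>h\<close> is constant in \<open>x\<close>.
  Any version \<open>g\<close> is allowed, so the result applies to the one picked by
  \<open>SOME\<close>.\<close>

lemma (in prob_space) tail_coefficient_cases:
  assumes X: "\<And>t. X t \<in> borel_measurable M"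
    and Y: "\<And>t. Y t \<in> borel_measurable M"
    and Z: "\<And>t. (Z t :: 'a \<Rightarrow> 'z::euclidean_space) \<in> borel_measurable M"
    and \<mu>: "real_distribution \<mu>" and F: "F = cdf \<mu>"
    and gen: "structurally_generated M N X Y Z \<epsilon> h A"
    and pos: "\<And>v. AE \<omega> in M. 0 < cond_prob_exceed M (info_without_X M Y Z t) (X t) v \<omega>"
    and g: "is_tail_coefficient M F X Y t (info_without_X M Y Z t) g"
  shows "\<forall>(y, z, e)\<in>A. filterlim (\<lambda>x. h x y z e) at_top at_top \<Longrightarrow> AE \<omega> in M. g \<omega> = 1"
    and "\<forall>(y, z, e)\<in>A. \<forall>x x'. h x y z e = h x' y z e \<Longrightarrow>
      AE \<omega> in M. g \<omega> = baseline_coefficient M F Y t (info_without_X M Y Z t) \<omega>"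
proof -
  interpret \<mu>: real_distribution \<mu> by (rule \<mu>)
  let ?W = "joint_process X Y Z"
  \<comment> \<open>\<open>?H\<close> is the full past up to and including time \<open>t\<close>;
    the index set \<open>{..<t + 1}\<close> matches the independence assumption on the noise at time
    \<open>t + 1\<close>.\<close>
  let ?G = "info_without_X M Y Z t" and ?H = "generated_sigma M borel ?W {..<t + 1}"
  let ?T = "\<lambda>\<omega>. (Y t \<omega>, Z t \<omega>)" and ?\<xi> = "\<epsilon> (t + 1)"
  note [measurable] = X Y Z
  have W: "?W s \<in> borel_measurable M" for s
    unfolding joint_process_def by (simp add: borel_prod[symmetric])
  have H: "subalgebra M ?H"
    by (rule subalgebra_generated_sigma) (simp_all add: W)
  have WH: "?W s \<in> borel_measurable ?H" if "s < t + 1" for s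
    by (rule generated_sigma_measurable) (use that in auto)
  have VH: "X s \<in> borel_measurable ?H" "(\<lambda>\<omega>. (Y s \<omega>, Z s \<omega>)) \<in> borel_measurable ?H"
    if "s < t + 1" for s
  proof -
    have [measurable]: "?W s \<in> measurable ?H (borel \<Otimes>\<^sub>M (borel \<Otimes>\<^sub>M borel))"
      using WH[OF that] by (simp add: borel_prod)
    have "(\<lambda>\<omega>. fst (?W s \<omega>)) \<in> borel_measurable ?H" by measurable
    then show "X s \<in> borel_measurable ?H" by (simp add: joint_process_def)
    have "(\<lambda>\<omega>. snd (?W s \<omega>)) \<in> measurable ?H (borel \<Otimes>\<^sub>M borel)" by measurable
    then show "(\<lambda>\<omega>. (Y s \<omega>, Z s \<omega>)) \<in> borel_measurable ?H"
      by (simp add: joint_process_def borel_prod)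
  qed
  have G: "subalgebra ?H ?G"
    unfolding info_without_X_def
    by (rule subalgebra_generated_sigma) (auto intro!: VH)
  have MG: "subalgebra M ?G" using H G by (auto simp: subalgebra_def)
  interpret G: sigma_finite_subalgebra M ?G
    using subalgebra_imp_sigma_finite[OF MG] .
  have T0: "?T \<in> borel_measurable ?G"
    unfolding info_without_X_def by (rule generated_sigma_measurable) auto
  then have T[measurable]: "?T \<in> measurable ?G (borel \<Otimes>\<^sub>M borel)"
    by (simp add: borel_prod)
  have \<xi>[measurable]: "?\<xi> \<in> measurable M N"
    and hm: "(\<lambda>(x, y, z, e). h x y z e) \<in> borel_measurable (borel \<Otimes>\<^sub>M (borel \<Otimes>\<^sub>M (borel \<Otimes>\<^sub>M N)))"
    and A[measurable]: "A \<in> sets (borel \<Otimes>\<^sub>M (borel \<Otimes>\<^sub>M N))"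
    and ind: "indep_set (sets (vimage_algebra (space M) ?\<xi> N)) (sets ?H)"
    and AEA: "AE \<omega> in M. (Y t \<omega>, Z t \<omega>, ?\<xi> \<omega>) \<in> A"
    and AEY: "AE \<omega> in M. Y (t + 1) \<omega> = h (X t \<omega>) (Y t \<omega>) (Z t \<omega>) (?\<xi> \<omega>)"
    \<comment> \<open>The structural equation is taken at \<open>t + 1\<close>, so its arguments are
      the variables at time \<open>t\<close>.\<close>
    using gen[unfolded structurally_generated_def, THEN conjunct2, THEN conjunct2, THEN conjunct2,
        THEN spec[of _ "t + 1"]] gen
    by (simp_all add: structurally_generated_def)
  define \<nu> where "\<nu> = distr M N ?\<xi>"
  interpret \<nu>: prob_space \<nu> unfolding \<nu>_def by (rule prob_space_distr) measurable
  have [measurable_cong]: "sets \<nu> = sets N" by (simp add: \<nu>_def)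
  have noise: "regular_cond_distr M ?H N ?\<xi> (\<lambda>_. \<nu>)"
    unfolding \<nu>_def
  proof (rule regular_cond_distr_indep[OF H \<xi>])
    fix a b assume a: "a \<in> sets ?H" and b: "b \<in> sets N"
    have "a \<subseteq> space M" using sets.sets_into_space[OF a] by simp
    then have "a \<inter> ?\<xi> -` b = (?\<xi> -` b \<inter> space M) \<inter> a" by auto
    then show "prob (a \<inter> ?\<xi> -` b) = prob a * prob (?\<xi> -` b \<inter> space M)"
      using indep_setD[OF ind in_vimage_algebra[OF b] a] by simp
  qed
  obtain \<kappa> where \<kappa>: "regular_cond_distr M ?G borel (X t) \<kappa>"
    using ex_regular_cond_distr_real[OF MG X] by blast
  have krd: "real_distribution (\<kappa> \<omega>)" if "\<omega> \<in> space M" for \<omega>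
    using regular_cond_distrD[OF \<kappa> MG that]
    by (simp add: real_distribution_def real_distribution_axioms_def)
  have Fm[measurable]: "F \<in> borel_measurable borel"
    unfolding F by (rule borel_measurable_mono) (auto simp: mono_def \<mu>.cdf_nondecreasing)
  have F0: "0 \<le> F x" and F1: "F x \<le> 1" for x
    by (simp_all add: F \<mu>.cdf_nonneg \<mu>.cdf_bounded_prob)
  \<comment> \<open>The pair of \<open>y\<close> and \<open>z\<close> is bundled into one argument
    \<open>c\<close>, the value of the \<open>?G\<close>-measurable variable
    \<open>?T\<close>.\<close>
  define f where "f = (\<lambda>(x, c, e). F (h x (fst c) (snd c) e))"
  have "(\<lambda>(x, c, e). (x, fst c, snd c, e)) \<in>
      measurable (borel \<Otimes>\<^sub>M ((borel \<Otimes>\<^sub>M borel) \<Otimes>\<^sub>M N)) (borel \<Otimes>\<^sub>M (borel \<Otimes>\<^sub>M (borel \<Otimes>\<^sub>M N)))"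
    by measurable
  from measurable_compose[OF measurable_compose[OF this hm] Fm]
  have f[measurable]: "f \<in> borel_measurable (borel \<Otimes>\<^sub>M ((borel \<Otimes>\<^sub>M borel) \<Otimes>\<^sub>M N))"
    by (simp add: f_def split_beta')
  have f01: "0 \<le> f p" "f p \<le> 1" for p
    by (auto simp: f_def F0 F1 split: prod.split)
  have f\<nu>[measurable]: "(\<lambda>e. f (x, c, e)) \<in> borel_measurable \<nu>" for x c
  proof -
    have [measurable]: "c \<in> space (borel \<Otimes>\<^sub>M borel)" by (simp add: space_pair_measure)
    have "(\<lambda>e. f (x, c, e)) \<in> borel_measurable N" by measurable
    then show ?thesis by (simp cong: measurable_cong_sets add: \<nu>_def)
  qed
  define \<Phi> where "\<Phi> x c = (\<integral>e. f (x, c, e) \<partial>\<nu>)" for x c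
  have \<Phi>m: "(\<lambda>x. \<Phi> x c) \<in> borel_measurable borel" for c
  proof -
    have [measurable]: "c \<in> space (borel \<Otimes>\<^sub>M borel)" by (simp add: space_pair_measure)
    have "(\<lambda>(x, e). f (x, c, e)) \<in> borel_measurable (borel \<Otimes>\<^sub>M N)" by measurable
    then have "(\<lambda>(x, e). f (x, c, e)) \<in> borel_measurable (borel \<Otimes>\<^sub>M \<nu>)"
      by (simp cong: measurable_cong_sets add: \<nu>_def)
    then show ?thesis
      unfolding \<Phi>_def by (rule \<nu>.borel_measurable_lebesgue_integral)
  qed
  have \<Phi>b: "\<bar>\<Phi> x c\<bar> \<le> 1" for x c
  proof -
    have "integrable \<nu> (\<lambda>e. f (x, c, e))"
      by (rule \<nu>.integrable_const_bound[where B=1]) (auto simp: f01)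
    then have "\<Phi> x c \<le> 1" unfolding \<Phi>_def by (intro \<nu>.integral_le_const) (auto simp: f01)
    moreover have "0 \<le> \<Phi> x c" unfolding \<Phi>_def by (rule integral_nonneg_AE) (simp add: f01)
    ultimately show ?thesis by simp
  qed
  \<comment> \<open>Half-lines \<open>S\<close> give the numerators of the tail coefficient and
    \<open>S = UNIV\<close> gives the baseline. The function \<open>u\<close> is only required to
    agree with the product on \<open>space M\<close>, which covers both ways in which the integrand
    is written.\<close>
  have key: "AE \<omega> in M. real_cond_exp M ?G u \<omega> = (\<integral>x. \<Phi> x (?T \<omega>) * indicator S x \<partial>\<kappa> \<omega>)"
    if S: "S \<in> sets borel" and u: "u \<in> borel_measurable M"
      and ueq: "\<And>\<omega>. \<omega> \<in> space M \<Longrightarrow> u \<omega> = F (Y (t + 1) \<omega>) * indicator S (X t \<omega>)" for S u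
  proof -
    note [measurable] = S u
    have [measurable]: "(\<lambda>\<omega>. f (X t \<omega>, ?T \<omega>, ?\<xi> \<omega>)) \<in> borel_measurable M"
      using measurable_from_subalg[OF MG T] by measurable
    have 1: "AE \<omega> in M. real_cond_exp M ?G u \<omega> =
        real_cond_exp M ?G (\<lambda>\<omega>. f (X t \<omega>, ?T \<omega>, ?\<xi> \<omega>) * indicator S (X t \<omega>)) \<omega>"
    proof (rule G.real_cond_exp_cong[OF _ u])
      show "AE \<omega> in M. u \<omega> = f (X t \<omega>, ?T \<omega>, ?\<xi> \<omega>) * indicator S (X t \<omega>)"
        using AEY AE_space by eventually_elim (simp add: f_def ueq)
    qed measurable
    have 2: "AE \<omega> in M. real_cond_exp M ?G (\<lambda>\<omega>. f (X t \<omega>, ?T \<omega>, ?\<xi> \<omega>) * indicator S (X t \<omega>)) \<omega>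
        = (\<integral>x. \<Phi> x (?T \<omega>) * indicator S x \<partial>\<kappa> \<omega>)"
      unfolding \<Phi>_def
      by (rule real_cond_exp_indep_noise[OF H G VH(1) T \<xi> noise \<kappa> f f01 S]) simp
    from 1 2 show ?thesis by eventually_elim simp
  qed
  have cpe: "AE \<omega> in M. cond_prob_exceed M ?G (X t) v \<omega> = measure (\<kappa> \<omega>) {v<..}" for v
  proof -
    have 1: "AE \<omega> in M. cond_prob_exceed M ?G (X t) v \<omega>
        = real_cond_exp M ?G (\<lambda>\<omega>. (\<lambda>(\<omega>, x). indicator {v<..} x) (\<omega>, X t \<omega>)) \<omega>"
      unfolding cond_prob_exceed_def
      by (rule G.real_cond_exp_cong) (auto simp: indicator_def)
    have 2: "AE \<omega> in M. real_cond_exp M ?G (\<lambda>\<omega>. (\<lambda>(\<omega>, x). indicator {v<..} x) (\<omega>, X t \<omega>)) \<omega>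
        = (\<integral>x. (\<lambda>(\<omega>, x). indicator {v<..} x) (\<omega>, x) \<partial>\<kappa> \<omega>)"
      by (rule regular_cond_distr_real_cond_exp[OF \<kappa> MG X, where B=1]) (measurable, auto simp: indicator_def)
    from 1 2 AE_space show ?thesis
    proof eventually_elim
      case (elim \<omega>)
      then show ?case using regular_cond_distrD[OF \<kappa> MG, of \<omega>] by simp
    qed
  qed
  obtain R where R: "\<And>v. AE \<omega> in M. R v \<omega> = cond_exp_exceed M ?G (\<lambda>\<omega>. F (Y (t + 1) \<omega>)) (X t) v \<omega>"
    and Rlim: "AE \<omega> in M. ((\<lambda>v. R v \<omega>) \<longlongrightarrow> g \<omega>) at_top"
    using g unfolding is_tail_coefficient_def by blast
  \<comment> \<open>Each \<open>R v\<close> is identified only off a null set depending on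
    \<open>v\<close>. Restricting to natural thresholds leaves a single null set, and the limit in
    \<open>v\<close> can still be read off along them.\<close>
  have Rn: "AE \<omega> in M. \<forall>n::nat. R (real n) \<omega> =
      (\<integral>x. \<Phi> x (?T \<omega>) * indicator {real n<..} x \<partial>\<kappa> \<omega>) / measure (\<kappa> \<omega>) {real n<..}"
    unfolding AE_all_countable
  proof
    fix n :: nat
    have "AE \<omega> in M. real_cond_exp M ?G
        (\<lambda>\<omega>'. F (Y (t + 1) \<omega>') * indicator {\<omega> \<in> space M. real n < X t \<omega>} \<omega>') \<omega>
        = (\<integral>x. \<Phi> x (?T \<omega>) * indicator {real n<..} x \<partial>\<kappa> \<omega>)"
      by (rule key) (auto simp: indicator_def)
    with R[of "real n"] cpe[of "real n"]
    show "AE \<omega> in M. R (real n) \<omega> =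
      (\<integral>x. \<Phi> x (?T \<omega>) * indicator {real n<..} x \<partial>\<kappa> \<omega>) / measure (\<kappa> \<omega>) {real n<..}"
      by eventually_elim (simp add: cond_exp_exceed_def)
  qed
  have kpos: "AE \<omega> in M. \<forall>n::nat. 0 < measure (\<kappa> \<omega>) {real n<..}"
    unfolding AE_all_countable
  proof
    fix n :: nat
    from pos[of "real n"] cpe[of "real n"] show "AE \<omega> in M. 0 < measure (\<kappa> \<omega>) {real n<..}"
      by eventually_elim simp
  qed
  \<comment> \<open>The limit \<open>l\<close> is quantified inside the almost sure statement, so it
    may depend on \<open>\<omega>\<close>; the two cases below insert 1 and
    \<open>\<Phi> 0 (?T \<omega>)\<close>.\<close>
  have g_lim: "AE \<omega> in M. \<forall>l. ((\<lambda>x. \<Phi> x (?T \<omega>)) \<longlongrightarrow> l) at_top \<longrightarrow> g \<omega> = l"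
    using Rn kpos Rlim AE_space
  proof eventually_elim
    case (elim \<omega>)
    show ?case
    proof (intro allI impI)
      fix l assume l: "((\<lambda>x. \<Phi> x (?T \<omega>)) \<longlongrightarrow> l) at_top"
      have "(\<lambda>n::nat. R (real n) \<omega>) \<longlonglongrightarrow> l"
        using tail_average_tendsto[OF krd \<Phi>m \<Phi>b l, of \<omega>] elim by simp
      moreover have "(\<lambda>n::nat. R (real n) \<omega>) \<longlonglongrightarrow> g \<omega>"
        using elim(3) filterlim_real_sequentially by (rule filterlim_compose)
      ultimately show "g \<omega> = l" using LIMSEQ_unique by blast
    qed
  qed
  \<comment> \<open>Membership in \<open>A\<close> is assumed for the realized noise. Independence
    extends it, for almost every fixed \<open>\<omega>\<close>, to \<nu>-almost every noise value,
    so the assumptions on \<open>h\<close> can be used under the integral defining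
    \<open>\<Phi>\<close>.\<close>
  have AEn: "AE \<omega> in M. AE e in \<nu>. (Y t \<omega>, Z t \<omega>, e) \<in> A"
  proof -
    let ?q = "\<lambda>(\<omega>, e). (Y t \<omega>, Z t \<omega>, e)"
    have Tf[measurable]: "Y t \<in> borel_measurable ?H" "Z t \<in> borel_measurable ?H"
      using measurable_compose[OF measurable_from_subalg[OF G T] measurable_fst]
        measurable_compose[OF measurable_from_subalg[OF G T] measurable_snd] by auto
    have "?q \<in> measurable (?H \<Otimes>\<^sub>M N) (borel \<Otimes>\<^sub>M (borel \<Otimes>\<^sub>M N))" by measurable
    from measurable_sets[OF this A]
    have "AE \<omega> in M. AE e in \<nu>. (\<omega>, e) \<in> ?q -` A \<inter> space (?H \<Otimes>\<^sub>M N)"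
    proof (rule AE_regular_cond_distr[OF noise H \<xi>])
      show "AE \<omega> in M. (\<omega>, ?\<xi> \<omega>) \<in> ?q -` A \<inter> space (?H \<Otimes>\<^sub>M N)"
        using AEA AE_space
        by eventually_elim (auto simp: space_pair_measure intro: measurable_space[OF \<xi>])
    qed
    then show ?thesis by (rule AE_mp) (auto intro!: AE_I2 elim: eventually_mono)
  qed
  show "AE \<omega> in M. g \<omega> = 1"
    if lim: "\<forall>(y, z, e)\<in>A. filterlim (\<lambda>x. h x y z e) at_top at_top"
    using AEn g_lim
  proof eventually_elim
    case (elim \<omega>)
    \<comment> \<open>Dominated convergence in the noise variable: \<open>h\<close> diverges and
      \<open>F\<close> tends to 1 at infinity, while \<open>f\<close> is bounded by 1. Since
      \<open>\<nu>\<close> has mass 1, the limit is 1.\<close>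
    have "((\<lambda>x. \<Phi> x (?T \<omega>)) \<longlongrightarrow> (\<integral>e. 1 \<partial>\<nu>)) at_top"
      unfolding \<Phi>_def
    proof (rule integral_dominated_convergence_at_top[where w="\<lambda>_. 1"])
      show "AE e in \<nu>. ((\<lambda>x. f (x, ?T \<omega>, e)) \<longlongrightarrow> 1) at_top"
        using elim(1)
      proof eventually_elim
        case (elim e)
        then have "filterlim (\<lambda>x. h x (Y t \<omega>) (Z t \<omega>) e) at_top at_top" using lim by auto
        from filterlim_compose[OF \<mu>.cdf_lim_at_top_prob this]
        show ?case by (simp add: f_def F)
      qed
    qed (auto simp: f01)
    then show "g \<omega> = 1" using elim(2) by (simp add: \<nu>.prob_space)
  qed
  show "AE \<omega> in M. g \<omega> = baseline_coefficient M F Y t ?G \<omega>"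
    if const: "\<forall>(y, z, e)\<in>A. \<forall>x x'. h x y z e = h x' y z e"
  proof -
    have base: "AE \<omega> in M. baseline_coefficient M F Y t ?G \<omega> = (\<integral>x. \<Phi> x (?T \<omega>) * indicator UNIV x \<partial>\<kappa> \<omega>)"
      unfolding baseline_coefficient_def by (rule key) auto
    from base AEn g_lim AE_space show ?thesis
    proof eventually_elim
      case (elim \<omega>)
      interpret K: real_distribution "\<kappa> \<omega>" using krd elim(4) .
      \<comment> \<open>The point 0 is an arbitrary reference value; the exceptional noise values
        may be discarded since only the integral over them matters.\<close>
      have c: "\<Phi> x (?T \<omega>) = \<Phi> 0 (?T \<omega>)" for x
        unfolding \<Phi>_def
      proof (rule integral_cong_AE)
        show "AE e in \<nu>. f (x, ?T \<omega>, e) = f (0, ?T \<omega>, e)"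
          using elim(2)
        proof eventually_elim
          case (elim e)
          then have "h x (Y t \<omega>) (Z t \<omega>) e = h 0 (Y t \<omega>) (Z t \<omega>) e" using const by blast
          then show ?case by (simp add: f_def)
        qed
      qed auto
      have fun_c: "(\<lambda>x. \<Phi> x (?T \<omega>)) = (\<lambda>_. \<Phi> 0 (?T \<omega>))"
        by (rule ext) (rule c)
      have "g \<omega> = \<Phi> 0 (?T \<omega>)"
        using elim(3)[unfolded fun_c] by auto
      moreover have "baseline_coefficient M F Y t ?G \<omega> = (\<integral>x. \<Phi> 0 (?T \<omega>) \<partial>\<kappa> \<omega>)"
        unfolding elim(1) by (rule Bochner_Integration.integral_cong) (simp, subst c, simp)
      then have "baseline_coefficient M F Y t ?G \<omega> = \<Phi> 0 (?T \<omega>)"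
        using K.prob_space by simp
      ultimately show ?case by simp
    qed
  qed
qed

section \<open>The two implications between tail and extremal causality\<close>

theorem proposition1:
  fixes M :: "'w measure"
    and X Y :: "int \<Rightarrow> 'w \<Rightarrow> real"
    and Z :: "int \<Rightarrow> 'w \<Rightarrow> 'z::euclidean_space"
    and F :: "real \<Rightarrow> real"
    and \<mu> :: "real measure"
    and U :: "int \<Rightarrow> 'w measure"
    and N :: "'e measure"
    and \<epsilon> :: "int \<Rightarrow> 'w \<Rightarrow> 'e"
    and h :: "real \<Rightarrow> real \<Rightarrow> 'z \<Rightarrow> 'e \<Rightarrow> real"
    and A :: "(real \<times> 'z \<times> 'e) set"
  defines "C \<equiv> info_without_X M Y Z"
  assumes "prob_space M"
    and "\<And>t. X t \<in> borel_measurable M"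
    and "\<And>t. Y t \<in> borel_measurable M"
    and "\<And>t. Z t \<in> borel_measurable M"
    and "one_markov M (joint_process X Y Z)"
    and "\<And>t. supported_near_infinity M (X t)"
    and "\<And>t. supported_near_infinity M (Y t)"
    and "real_distribution \<mu>" and "F = cdf \<mu>" and "\<And>x. F x < 1"
    and "coefficients_well_defined M F X Y C"
    and "available_information M (joint_process X Y Z) U"
    and "causally_sufficient M F U X Y C"
  shows "(causes_in_extremes M F X Y C \<longrightarrow> causes_in_tail M F X Y C) \<and>
    (structurally_generated M N X Y Z \<epsilon> h A \<and>
       ((\<forall>(y, z, e)\<in>A. filterlim (\<lambda>x. h x y z e) at_top at_top) \<or>
        (\<forall>(y, z, e)\<in>A. \<forall>x x'. h x y z e = h x' y z e)) \<longrightarrow>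
     causes_in_tail M F X Y C \<longrightarrow> causes_in_extremes M F X Y C)"
proof -
  interpret prob_space M by fact
  note X = \<open>\<And>t. X t \<in> borel_measurable M\<close>
    and Y[measurable] = \<open>\<And>t. Y t \<in> borel_measurable M\<close>
    and Z[measurable] = \<open>\<And>t. Z t \<in> borel_measurable M\<close>
  interpret \<mu>: real_distribution \<mu> by fact
  have Fm[measurable]: "F \<in> borel_measurable borel"
    unfolding \<open>F = cdf \<mu>\<close>
    by (rule borel_measurable_mono) (auto simp: mono_def \<mu>.cdf_nondecreasing)
  have F0: "0 \<le> F x" for x
    by (simp add: \<open>F = cdf \<mu>\<close> \<mu>.cdf_nonneg)
  \<comment> \<open>Well-definedness supplies a witness, so the function chosen by
    \<open>SOME\<close> really is a tail coefficient.\<close>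
  have tail: "is_tail_coefficient M F X Y t (C t) (tail_coefficient M F X Y t (C t))"
    and pos: "AE \<omega> in M. 0 < cond_prob_exceed M (C t) (X t) v \<omega>" for t v
    using \<open>coefficients_well_defined M F X Y C\<close>
    unfolding coefficients_well_defined_def tail_coefficient_def some_eq_ex by simp_all
  \<comment> \<open>Conditional expectation preserves strict upper bounds almost surely, so
    \<open>F < 1\<close> pointwise passes to the baseline.\<close>
  have baseline: "AE \<omega> in M. baseline_coefficient M F Y t (C t) \<omega> < 1" for t
  proof -
    have C: "subalgebra M (C t)"
      unfolding C_def info_without_X_def
      by (rule subalgebra_generated_sigma) (auto simp: borel_prod[symmetric])
    interpret C: sigma_finite_subalgebra M "C t"
      using subalgebra_imp_sigma_finite[OF C] .
    have "integrable M (\<lambda>\<omega>. F (Y (t + 1) \<omega>))"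
      by (rule integrable_const_bound[where B=1])
         (auto simp: F0 less_imp_le[OF \<open>\<And>x. F x < 1\<close>])
    then show ?thesis
      unfolding baseline_coefficient_def
      by (intro C.real_cond_exp_less_c) (simp_all add: \<open>\<And>x. F x < 1\<close>)
  qed
  have "causes_in_tail M F X Y C" if ext: "causes_in_extremes M F X Y C"
  proof -
    obtain t where t: "AE \<omega> in M. tail_coefficient M F X Y t (C t) \<omega> = 1"
      using ext unfolding causes_in_extremes_def by blast
    have "\<not> (AE \<omega> in M. tail_coefficient M F X Y t (C t) \<omega> = baseline_coefficient M F Y t (C t) \<omega>)"
    proof
      assume "AE \<omega> in M. tail_coefficient M F X Y t (C t) \<omega> = baseline_coefficient M F Y t (C t) \<omega>"
      \<comment> \<open>An almost surely false statement is impossible in a probability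
        space.\<close>
      with t baseline[of t] have "AE \<omega> in M. False" by eventually_elim simp
      then show False by simp
    qed
    then show ?thesis unfolding causes_in_tail_def by blast
  qed
  moreover have "causes_in_extremes M F X Y C"
    if gen: "structurally_generated M N X Y Z \<epsilon> h A"
      and h: "(\<forall>(y, z, e)\<in>A. filterlim (\<lambda>x. h x y z e) at_top at_top) \<or>
        (\<forall>(y, z, e)\<in>A. \<forall>x x'. h x y z e = h x' y z e)"
      and "causes_in_tail M F X Y C"
  proof -
    obtain t where t: "\<not> (AE \<omega> in M. tail_coefficient M F X Y t (C t) \<omega> = baseline_coefficient M F Y t (C t) \<omega>)"
      using \<open>causes_in_tail M F X Y C\<close> unfolding causes_in_tail_def by blast
    \<comment> \<open>At the time \<open>t\<close> witnessing tail causality, constancy in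
      \<open>x\<close> would force the two coefficients to agree. Divergence must therefore hold,
      and it makes the tail coefficient 1 at the same \<open>t\<close>.\<close>
    note limits = tail_coefficient_cases[OF X Y Z \<open>real_distribution \<mu>\<close> \<open>F = cdf \<mu>\<close> gen
        pos[unfolded C_def] tail[unfolded C_def], of t, folded C_def]
    from h show ?thesis
      unfolding causes_in_extremes_def using limits t by blast
  qed
  ultimately show ?thesis by blast
qed

end
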